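(* Let $M$ be an atomic JBW-algebra with unit $e$. Then the following are equivalent: (i) $M=M_1\oplus M_2$ as a direct sum of JBW-subalgebras; (ii) $M\cong S\times T$ as an internal order product; (iii) $M_+\cong C_1\times C_2$ as an internal order product; (iv) $[0,e]\cong[0,x]\times[0,y]$ as an internal order product for some $x,y\in M$; (v) $[0,e]\cong[0,z]\times[0,z^\perp]$ as an internal order product for some central projection $z\in M$. Moreover, all these types of decompositions are in bijection with each other.
   Context: A JB-algebra is a real Banach space $A$ with a commutative bilinear product $\circ$ satisfying $x\circ(y\circ x^2)=(x\circ y)\circ x^2$, $\|x\circ y\|\le\|x\|\|y\|$, $\|x^2\|=\|x\|^2$ and $\|x^2\|\le\|x^2+y^2\|$ for all $x,y\in A$. A JBW-algebra is a JB-algebra that is a dual Banach space; it has a unit $e$. $M_+$ is the cone of squares; $x\le y$ means $y-x\in M_+$; $[x,y]=\{w: x\le w\le y\}$. A projection is an element $p$ with $p^2=p$, and $p^\perp:=e-p$; an atom is a minimal non-zero projection; $M$ is atomic if every non-zero projection dominates an atom. Elements $x,y$ operator commute if $x\circ(y\circ w)=y\circ(x\circ w)$ for all $w\in M$; an element is central if it operator commutes with all elements of $M$. A direct sum $M=M_1\oplus M_2$ of JBW-subalgebras is a direct sum of algebras: every element is uniquely a sum $a+b$ with $a\in M_1$, $b\in M_2$, with coordinatewise operations. Internal order product: let $P$ be a partially ordered set with distinguished element $0$ (not necessarily the least element), and let $P_1,P_2$ be subposets containing $0$. Then $P$ is the internal order product of $P_1$ and $P_2$, written $P\cong P_1\times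 P_2$, if there is an order isomorphism (bijection preserving order in both directions) from $P$ to the cartesian product $P_1\times P_2$ with coordinatewise order which sends each $p_1\in P_1$ to $(p_1,0)$ and each $p_2\in P_2$ to $(0,p_2)$. In (ii) $S,T$ are subposets of $M$ containing $0$; in (iii) $C_1,C_2$ are subposets of $M_+$ containing $0$; in (iv) and (v) the two factors are subposets of $[0,e]$. The distinguished element is always $0\in M$. *)

theory Defs
  imports "HOL-Analysis.Analysis"
begin

locale jb_algebra =
  fixes jp :: "'a::banach \<Rightarrow> 'a \<Rightarrow> 'a"  (infixl "\<odot>" 70)
  assumes bilinear: "bilinear (\<odot>)"
    and commutative: "x \<odot> y = y \<odot> x"
    and jordan_identity: "x \<odot> (y \<odot> (x \<odot> x)) = (x \<odot> y) \<odot> (x \<odot> x)"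
    and norm_prod_le: "norm (x \<odot> y) \<le> norm x * norm y"
    and norm_square: "norm (x \<odot> x) = (norm x)\<^sup>2"
    and norm_square_le: "norm (x \<odot> x) \<le> norm (x \<odot> x + y \<odot> y)"

text \<open>
  Being a dual Banach space is witnessed by a Banach space \<open>'p\<close> and an isometric
  linear bijection \<open>\<Phi>\<close> of the algebra onto the dual of \<open>'p\<close>.
\<close>

locale jbw_algebra = jb_algebra jp
  for jp :: "'a::banach \<Rightarrow> 'a \<Rightarrow> 'a"  (infixl "\<odot>" 70) +
  fixes \<Phi> :: "'a \<Rightarrow> ('p::banach \<Rightarrow>\<^sub>L real)"
  assumes dual_linear: "linear \<Phi>"
    and dual_isometric: "norm (\<Phi> x) = norm x"
    and dual_surj: "surj \<Phi>"

definition is_unit_element :: "('a \<Rightarrow> 'a \<Rightarrow> 'a) \<Rightarrow> 'a \<Rightarrow> bool" where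
  "is_unit_element jp e \<longleftrightarrow> (\<forall>x. jp e x = x \<and> jp x e = x)"

definition pos_cone :: "('a \<Rightarrow> 'a \<Rightarrow> 'a) \<Rightarrow> 'a set" where
  "pos_cone jp = range (\<lambda>x. jp x x)"

definition jb_le :: "('a::ab_group_add \<Rightarrow> 'a \<Rightarrow> 'a) \<Rightarrow> 'a \<Rightarrow> 'a \<Rightarrow> bool" where
  "jb_le jp x y \<longleftrightarrow> y - x \<in> pos_cone jp"

definition order_interval :: "('a::ab_group_add \<Rightarrow> 'a \<Rightarrow> 'a) \<Rightarrow> 'a \<Rightarrow> 'a \<Rightarrow> 'a set" where
  "order_interval jp x y = {w. jb_le jp x w \<and> jb_le jp w y}"

definition projection :: "('a \<Rightarrow> 'a \<Rightarrow> 'a) \<Rightarrow> 'a \<Rightarrow> bool" where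
  "projection jp p \<longleftrightarrow> jp p p = p"

definition atom :: "('a::ab_group_add \<Rightarrow> 'a \<Rightarrow> 'a) \<Rightarrow> 'a \<Rightarrow> bool" where
  "atom jp p \<longleftrightarrow> projection jp p \<and> p \<noteq> 0 \<and>
     (\<forall>q. projection jp q \<and> q \<noteq> 0 \<and> jb_le jp q p \<longrightarrow> q = p)"

definition atomic :: "('a::ab_group_add \<Rightarrow> 'a \<Rightarrow> 'a) \<Rightarrow> bool" where
  "atomic jp \<longleftrightarrow> (\<forall>p. projection jp p \<and> p \<noteq> 0 \<longrightarrow> (\<exists>q. atom jp q \<and> jb_le jp q p))"

definition operator_commute :: "('a \<Rightarrow> 'a \<Rightarrow> 'a) \<Rightarrow> 'a \<Rightarrow> 'a \<Rightarrow> bool" where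
  "operator_commute jp x y \<longleftrightarrow> (\<forall>w. jp x (jp y w) = jp y (jp x w))"

definition central :: "('a \<Rightarrow> 'a \<Rightarrow> 'a) \<Rightarrow> 'a \<Rightarrow> bool" where
  "central jp x \<longleftrightarrow> (\<forall>y. operator_commute jp x y)"

text \<open>
  A JBW-subalgebra is a weak*-closed Jordan subalgebra. On the dual of \<open>'p\<close> the strong
  operator topology is the topology of pointwise convergence on \<open>'p\<close>, that is, the weak*
  topology.  The subalgebra need not contain the unit of the ambient algebra.
\<close>

definition jbw_subalgebra ::
    "('a::banach \<Rightarrow> 'a \<Rightarrow> 'a) \<Rightarrow> ('a \<Rightarrow> ('p::banach \<Rightarrow>\<^sub>L real)) \<Rightarrow> 'a set \<Rightarrow> bool" where
  "jbw_subalgebra jp \<Phi> N \<longleftrightarrow> subspace N \<and> (\<forall>x\<in>N. \<forall>y\<in>N. jp x y \<in> N) \<and>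
     closedin strong_operator_topology (\<Phi> ` N)"

definition jbw_direct_sum ::
    "('a::banach \<Rightarrow> 'a \<Rightarrow> 'a) \<Rightarrow> ('a \<Rightarrow> ('p::banach \<Rightarrow>\<^sub>L real)) \<Rightarrow> 'a set \<Rightarrow> 'a set \<Rightarrow> bool" where
  "jbw_direct_sum jp \<Phi> M1 M2 \<longleftrightarrow>
     jbw_subalgebra jp \<Phi> M1 \<and> jbw_subalgebra jp \<Phi> M2 \<and>
     (\<forall>x. \<exists>!(a, b). a \<in> M1 \<and> b \<in> M2 \<and> x = a + b) \<and>
     (\<forall>a\<in>M1. \<forall>b\<in>M2. \<forall>a'\<in>M1. \<forall>b'\<in>M2. jp (a + b) (a' + b') = jp a a' + jp b b')"

text \<open>The distinguished element \<open>z\<close> need not be the least element of \<open>P\<close>.\<close>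

definition internal_order_product ::
    "('a \<Rightarrow> 'a \<Rightarrow> bool) \<Rightarrow> 'a \<Rightarrow> 'a set \<Rightarrow> 'a set \<Rightarrow> 'a set \<Rightarrow> bool" where
  "internal_order_product le z P P1 P2 \<longleftrightarrow>
     P1 \<subseteq> P \<and> P2 \<subseteq> P \<and> z \<in> P1 \<and> z \<in> P2 \<and>
     (\<exists>\<phi>. bij_betw \<phi> P (P1 \<times> P2) \<and>
        (\<forall>x\<in>P. \<forall>y\<in>P. le x y \<longleftrightarrow> le (fst (\<phi> x)) (fst (\<phi> y)) \<and> le (snd (\<phi> x)) (snd (\<phi> y))) \<and>
        (\<forall>p\<in>P1. \<phi> p = (p, z)) \<and> (\<forall>p\<in>P2. \<phi> p = (z, p)))"

definition direct_sum_decomps ::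
    "('a::banach \<Rightarrow> 'a \<Rightarrow> 'a) \<Rightarrow> ('a \<Rightarrow> ('p::banach \<Rightarrow>\<^sub>L real)) \<Rightarrow> ('a set \<times> 'a set) set" where
  "direct_sum_decomps jp \<Phi> = {(M1, M2). jbw_direct_sum jp \<Phi> M1 M2}"

definition order_decomps :: "('a::banach \<Rightarrow> 'a \<Rightarrow> 'a) \<Rightarrow> ('a set \<times> 'a set) set" where
  "order_decomps jp = {(S, T). internal_order_product (jb_le jp) 0 UNIV S T}"

definition cone_decomps :: "('a::banach \<Rightarrow> 'a \<Rightarrow> 'a) \<Rightarrow> ('a set \<times> 'a set) set" where
  "cone_decomps jp = {(C1, C2). internal_order_product (jb_le jp) 0 (pos_cone jp) C1 C2}"

definition interval_decomps :: "('a::banach \<Rightarrow> 'a \<Rightarrow> 'a) \<Rightarrow> 'a \<Rightarrow> ('a \<times> 'a) set" where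
  "interval_decomps jp e = {(x, y). internal_order_product (jb_le jp) 0
     (order_interval jp 0 e) (order_interval jp 0 x) (order_interval jp 0 y)}"

definition central_decomps :: "('a::banach \<Rightarrow> 'a \<Rightarrow> 'a) \<Rightarrow> 'a \<Rightarrow> 'a set" where
  "central_decomps jp e = {z. projection jp z \<and> central jp z \<and>
     internal_order_product (jb_le jp) 0
       (order_interval jp 0 e) (order_interval jp 0 z) (order_interval jp 0 (e - z))}"

end

theory Submission
  imports Defs
begin

text \<open>
  Each kind of decomposition is given by a central projection \<open>z\<close>, namely the first component of
  the unit. The heart is the order theoretic case. If \<open>a\<close> and \<open>b\<close> lie in the two factors of a
  decomposition of \<open>[0, e]\<close>, their join \<open>s\<close> satisfies \<open>s \<le> a + b\<close>, and \<open>a + b - s\<close> is a positive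
  lower bound of \<open>a\<close> and \<open>b\<close>, so it vanishes: joins across the factors are sums. Hence \<open>e = x + y\<close>;
  the lower bound \<open>x - x\<^sup>2\<close> of \<open>x\<close> and \<open>y\<close> vanishes too, so \<open>x\<close> is a projection, and since every
  element of \<open>[0, e]\<close> splits as a sum of elements of \<open>[0, x]\<close> and \<open>[0, y]\<close>, there is no Peirce
  half-space and \<open>x\<close> is central. The positive cone is reduced to \<open>[0, e]\<close> by scaling, and the whole
  algebra to the cone by translating a base point to \<open>0\<close>.

  For a central projection \<open>z\<close> the range of multiplication by \<open>z\<close> is an M-summand, and M-summands of
  a dual space are weak*-closed; this is where the predual enters.
\<close>

section \<open>Sublinear functionals\<close>

text \<open>Spectral theory is avoided. For \<open>norm u \<le> 1\<close>, being a square amounts to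
  \<open>norm (e - u) \<le> 1\<close>, so facts about the cone become norm estimates, and square
  roots come from an iteration. The order isomorphisms are assumed neither additive nor homogeneous.
  Hence the result below \<open>e\<close> does not extend to the cone at once: the isomorphism is
  conjugated by dilations, and the resulting central projections must be shown to agree.
  JBW-subalgebras are weak*-closed by definition, while the axioms tie the product to the norm and
  not to the predual. So weak* information about \<open>z\<close> has to be extracted from the norm.
  Closedness of the unit ball of an M-summand is easy to see; the step from the ball to the whole
  summand, usually left to Krein-Smulian, is made here by showing that the M-projection has a
  preadjoint. This needs Hahn-Banach, Banach-Alaoglu and Grothendieck completeness. The projection
  \<open>0\<close> gives a decomposition of each kind, so the content of the theorem lies in the
  bijections.\<close>

definition sublinear :: "('v::real_vector \<Rightarrow> real) \<Rightarrow> bool" where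
  "sublinear q \<longleftrightarrow> (\<forall>x y. q (x + y) \<le> q x + q y) \<and> (\<forall>c\<ge>0. \<forall>x. q (c *\<^sub>R x) \<le> c * q x)"

lemma sublinearI:
  assumes "\<And>x y. q (x + y) \<le> q x + q y" "q 0 \<le> 0" "\<And>c x. c > 0 \<Longrightarrow> q (c *\<^sub>R x) \<le> c * q x"
  shows "sublinear q"
  unfolding sublinear_def
proof (intro conjI allI impI)
  fix c :: real and x assume "c \<ge> 0"
  then show "q (c *\<^sub>R x) \<le> c * q x"
    using assms(2) assms(3)[of c x] by (cases "c = 0") auto
qed (rule assms(1))

lemma sublinear_add: "sublinear q \<Longrightarrow> q (x + y) \<le> q x + q y"
  by (simp add: sublinear_def)

lemma sublinear_0: "sublinear q \<Longrightarrow> q 0 = 0"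
  unfolding sublinear_def by (metis add_cancel_right_right add_le_cancel_left mult_zero_left order_antisym
      order_refl scale_zero_left)

text \<open>The definition asks for one inequality only, the one that is easy to check; applying it
  to \<open>inverse c\<close> and \<open>c *\<^sub>R x\<close> gives the reverse.\<close>

lemma sublinear_scaleR:
  assumes q: "sublinear q" and c: "c \<ge> 0" shows "q (c *\<^sub>R x) = c * q x"
proof (cases "c = 0")
  case True
  then show ?thesis using sublinear_0[OF q] by simp
next
  case False
  then have c: "c > 0" using c by simp
  have "q (inverse c *\<^sub>R (c *\<^sub>R x)) \<le> inverse c * q (c *\<^sub>R x)"
    using q c unfolding sublinear_def by (meson inverse_nonnegative_iff_nonnegative less_imp_le)
  then have "c * q x \<le> q (c *\<^sub>R x)" using c by (simp add: field_simps)
  moreover have "q (c *\<^sub>R x) \<le> c * q x" using q c by (simp add: sublinear_def)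
  ultimately show ?thesis by simp
qed

lemma sublinear_minus_le: assumes "sublinear q" shows "- q (- x) \<le> q x"
  using sublinear_add[OF assms, of x "- x"] sublinear_0[OF assms] by simp

text \<open>Lowers \<open>q\<close> so as to become additive in the direction \<open>y\<close>.\<close>

definition flatten :: "('v::real_vector \<Rightarrow> real) \<Rightarrow> 'v \<Rightarrow> 'v \<Rightarrow> real" where
  "flatten q y x = (INF t\<in>{0..}. q (x + t *\<^sub>R y) - t * q y)"

text \<open>By subadditivity the values are bounded below by \<open>- q (- x)\<close> uniformly in
  \<open>t\<close>, so the infimum is a genuine one.\<close>

lemma flatten_le:
  assumes q: "sublinear q" and t: "t \<ge> 0"
  shows "flatten q y x \<le> q (x + t *\<^sub>R y) - t * q y"
  unfolding flatten_def
proof (rule cINF_lower)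
  show "bdd_below ((\<lambda>t. q (x + t *\<^sub>R y) - t * q y) ` {0..})"
  proof (rule bdd_belowI2)
    fix t :: real assume "t \<in> {0..}"
    then show "- q (- x) \<le> q (x + t *\<^sub>R y) - t * q y"
      using sublinear_add[OF q, of "x + t *\<^sub>R y" "- x"] sublinear_scaleR[OF q, of t y] by simp
  qed
qed (use t in simp)

lemma flatten_greatest:
  "(\<And>t. t \<ge> 0 \<Longrightarrow> m \<le> q (x + t *\<^sub>R y) - t * q y) \<Longrightarrow> m \<le> flatten q y x"
  unfolding flatten_def by (intro cINF_greatest) auto

text \<open>Parameters \<open>s\<close> for \<open>u\<close> and \<open>t\<close> for
  \<open>v\<close> combine to \<open>s + t\<close> for \<open>u + v\<close>, and \<open>t\<close>
  for \<open>x\<close> becomes \<open>c * t\<close> for \<open>c *\<^sub>R x\<close>.\<close>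

lemma sublinear_flatten:
  assumes q: "sublinear q" shows "sublinear (flatten q y)"
proof (rule sublinearI)
  fix u v
  have "flatten q y (u + v) \<le> (q (u + s *\<^sub>R y) - s * q y) + (q (v + t *\<^sub>R y) - t * q y)"
    if "s \<ge> 0" "t \<ge> 0" for s t
    using flatten_le[OF q, of "s + t" y "u + v"] that
      sublinear_add[OF q, of "u + s *\<^sub>R y" "v + t *\<^sub>R y"]
    by (simp add: algebra_simps)
  then have "flatten q y (u + v) - (q (v + t *\<^sub>R y) - t * q y) \<le> flatten q y u" if "t \<ge> 0" for t
    using that by (intro flatten_greatest) (simp add: algebra_simps)
  then have "flatten q y (u + v) - flatten q y u \<le> flatten q y v"
    by (intro flatten_greatest) (simp add: algebra_simps)
  then show "flatten q y (u + v) \<le> flatten q y u + flatten q y v" by simp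
next
  show "flatten q y 0 \<le> 0" using flatten_le[OF q, of 0 y 0] sublinear_0[OF q] by simp
next
  fix c :: real and x assume c: "c > 0"
  have "flatten q y (c *\<^sub>R x) / c \<le> q (x + t *\<^sub>R y) - t * q y" if "t \<ge> 0" for t
    using flatten_le[OF q, of "c * t" y "c *\<^sub>R x"] sublinear_scaleR[OF q, of c "x + t *\<^sub>R y"] c that
    by (simp add: field_simps scaleR_right_distrib)
  then have "flatten q y (c *\<^sub>R x) / c \<le> flatten q y x" by (rule flatten_greatest)
  then show "flatten q y (c *\<^sub>R x) \<le> c * flatten q y x" using c by (simp add: field_simps)
qed

text \<open>The common bound \<open>p\<close> keeps the infimum finite, above
  \<open>- p (- x)\<close>. Subadditivity uses the chain: given \<open>q\<close> at \<open>x\<close>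
  and \<open>r\<close> at \<open>y\<close>, the smaller of the two serves at both points.\<close>

lemma chain_INF_sublinear:
  assumes ne: "C \<noteq> {}" and C: "\<And>q. q \<in> C \<Longrightarrow> sublinear q \<and> q \<le> p"
    and chain: "\<And>q r. q \<in> C \<Longrightarrow> r \<in> C \<Longrightarrow> q \<le> r \<or> r \<le> q"
  shows "sublinear (\<lambda>x. INF q\<in>C. q x)" "\<And>q. q \<in> C \<Longrightarrow> (\<lambda>x. INF q\<in>C. q x) \<le> q"
proof -
  let ?u = "\<lambda>x. INF q\<in>C. q x"
  have lower: "?u x \<le> q x" if "q \<in> C" for q x
  proof (rule cINF_lower[OF _ that])
    show "bdd_below ((\<lambda>q. q x) ` C)"
    proof (rule bdd_belowI2)
      fix q assume "q \<in> C"
      then show "- p (- x) \<le> q x"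
        using C[of q] sublinear_minus_le[of q x] le_funD[of q p "- x"] by auto
    qed
  qed
  then show "?u \<le> q" if "q \<in> C" for q using that by (simp add: le_fun_def)
  have greatest: "m \<le> ?u x" if "\<And>q. q \<in> C \<Longrightarrow> m \<le> q x" for m x
    using ne that by (rule cINF_greatest)
  show "sublinear ?u"
  proof (rule sublinearI)
    fix x y
    have "?u (x + y) \<le> q x + r y" if "q \<in> C" "r \<in> C" for q r
      using chain[OF that]
    proof
      assume "q \<le> r"
      then show ?thesis
        using lower[OF that(1), of "x + y"] sublinear_add[of q x y] C[OF that(1)] le_funD[of q r y]
        by linarith
    next
      assume "r \<le> q"
      then show ?thesis
        using lower[OF that(2), of "x + y"] sublinear_add[of r x y] C[OF that(2)] le_funD[of r q x]
        by linarith
    qed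
    then have "?u (x + y) - r y \<le> ?u x" if "r \<in> C" for r
      using that by (intro greatest) (simp add: algebra_simps)
    then have "?u (x + y) - ?u x \<le> ?u y"
      by (intro greatest) (simp add: algebra_simps)
    then show "?u (x + y) \<le> ?u x + ?u y" by simp
  next
    obtain q where "q \<in> C" using ne by blast
    then show "?u 0 \<le> 0" using lower[of q 0] sublinear_0[of q] C by fastforce
  next
    fix c :: real and x assume c: "c > 0"
    have "?u (c *\<^sub>R x) / c \<le> q x" if "q \<in> C" for q
      using lower[OF that, of "c *\<^sub>R x"] sublinear_scaleR[of q c x] C[OF that] c
      by (simp add: field_simps)
    then have "?u (c *\<^sub>R x) / c \<le> ?u x" by (rule greatest)
    then show "?u (c *\<^sub>R x) \<le> c * ?u x" using c by (simp add: field_simps)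
  qed
qed

text \<open>The Hahn--Banach theorem: a minimal sublinear functional below \<open>p\<close> is linear.\<close>

theorem sublinear_dominates_linear:
  fixes p :: "'v::real_vector \<Rightarrow> real"
  assumes p: "sublinear p"
  obtains f where "linear f" "\<And>x. f x \<le> p x"
proof -
  define A where "A = {q. sublinear q \<and> q \<le> p}"
  have "\<exists>m\<in>A. \<forall>a\<in>A. a \<le> m \<longrightarrow> a = m"
  proof (rule predicate_Zorn)
    show "partial_order_on A (relation_of (\<lambda>x y. y \<le> x) A)"
      by (rule partial_order_on_relation_ofI) auto
    fix C assume "C \<in> Chains (relation_of (\<lambda>x y. y \<le> x) A)"
    then have C: "\<And>q. q \<in> C \<Longrightarrow> q \<in> A" "\<And>q r. q \<in> C \<Longrightarrow> r \<in> C \<Longrightarrow> q \<le> r \<or> r \<le> q"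
      unfolding Chains_def relation_of_def by blast+
    show "\<exists>u\<in>A. \<forall>a\<in>C. u \<le> a"
    proof (cases "C = {}")
      case True
      then show ?thesis using p by (auto simp: A_def)
    next
      case False
      let ?u = "\<lambda>x. INF q\<in>C. q x"
      have u: "sublinear ?u" "\<And>q. q \<in> C \<Longrightarrow> ?u \<le> q"
        using chain_INF_sublinear[OF False, of p] C by (auto simp: A_def)
      moreover obtain q where "q \<in> C" using False by blast
      ultimately have "?u \<in> A"
        using C(1)[of q] order_trans[OF u(2)[of q], of p] by (auto simp: A_def)
      then show ?thesis using u(2) by blast
    qed
  qed
  then obtain q where q: "sublinear q" "q \<le> p" and min: "\<And>r. sublinear r \<Longrightarrow> r \<le> p \<Longrightarrow> r \<le> q \<Longrightarrow> r = q"
    unfolding A_def by auto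
  \<comment> \<open>Minimality makes \<open>flatten q y\<close> equal to \<open>q\<close>; its
    parameter \<open>t = 1\<close> then yields the inequality opposite to subadditivity.\<close>
  have add: "q (x + y) = q x + q y" for x y
  proof -
    have "flatten q y \<le> q" using flatten_le[OF q(1), of 0 y] by (simp add: le_fun_def)
    then have "flatten q y = q"
      using sublinear_flatten[OF q(1)] q(2) by (intro min) auto
    then have "q x \<le> q (x + y) - q y"
      using flatten_le[OF q(1), of 1 y x] by simp
    then show ?thesis using sublinear_add[OF q(1), of x y] by simp
  qed
  have neg: "q (- x) = - q x" for x
    using add[of x "- x"] sublinear_0[OF q(1)] by simp
  have "linear q"
  proof (rule linearI)
    show "q (c *\<^sub>R x) = c *\<^sub>R q x" for c x
      using sublinear_scaleR[OF q(1), of c x] sublinear_scaleR[OF q(1), of "- c" x] neg[of "c *\<^sub>R x"]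
      by (cases "c \<ge> 0") simp_all
  qed (rule add)
  then show ?thesis using that q(2) by (auto simp: le_fun_def)
qed

text \<open>Infimal convolution: any linear \<open>f1\<close> below \<open>q\<close> will do, since
  \<open>h = 0\<close> bounds it by \<open>p1 x\<close>, and \<open>h = x\<close> at the point
  \<open>- x\<close> bounds \<open>f x - f1 x\<close> by \<open>p2 x\<close>. The bound on
  \<open>f\<close> keeps the infimum finite.\<close>

lemma linear_dominated_split:
  fixes f :: "'v::real_vector \<Rightarrow> real"
  assumes p1: "sublinear p1" and p2: "sublinear p2" and f: "linear f" "\<And>x. f x \<le> p1 x + p2 x"
  obtains f1 where "linear f1" "\<And>x. f1 x \<le> p1 x" "\<And>x. f x - f1 x \<le> p2 x"
proof -
  define q where "q x = (INF h. p1 (x + h) + p2 h - f h)" for x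
  have lower: "q x \<le> p1 (x + h) + p2 h - f h" for x h
    unfolding q_def
  proof (rule cINF_lower)
    show "bdd_below (range (\<lambda>h. p1 (x + h) + p2 h - f h))"
    proof (rule bdd_belowI2)
      show "- p1 (- x) \<le> p1 (x + h) + p2 h - f h" for h
        using sublinear_add[OF p1, of "x + h" "- x"] f(2)[of h] by simp
    qed
  qed simp
  have greatest: "m \<le> q x" if "\<And>h. m \<le> p1 (x + h) + p2 h - f h" for m x
    unfolding q_def using that by (intro cINF_greatest) auto
  have "sublinear q"
  proof (rule sublinearI)
    fix x y
    have "q (x + y) \<le> (p1 (x + h) + p2 h - f h) + (p1 (y + k) + p2 k - f k)" for h k
      using lower[of "x + y" "h + k"] sublinear_add[OF p1, of "x + h" "y + k"]
        sublinear_add[OF p2, of h k] by (simp add: linear_add[OF f(1)] algebra_simps)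
    then have "q (x + y) - (p1 (y + k) + p2 k - f k) \<le> q x" for k
      by (intro greatest) (simp add: algebra_simps)
    then have "q (x + y) - q x \<le> q y"
      by (intro greatest) (simp add: algebra_simps)
    then show "q (x + y) \<le> q x + q y" by simp
  next
    show "q 0 \<le> 0"
      using lower[of 0 0] by (simp add: sublinear_0 p1 p2 linear_0[OF f(1)])
  next
    fix c :: real and x assume c: "c > 0"
    have "q (c *\<^sub>R x) / c \<le> p1 (x + h) + p2 h - f h" for h
      using lower[of "c *\<^sub>R x" "c *\<^sub>R h"] sublinear_scaleR[OF p1, of c "x + h"]
        sublinear_scaleR[OF p2, of c h] c
      by (simp add: field_simps scaleR_right_distrib linear_cmul[OF f(1)])
    then have "q (c *\<^sub>R x) / c \<le> q x" by (rule greatest)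
    then show "q (c *\<^sub>R x) \<le> c * q x" using c by (simp add: field_simps)
  qed
  then obtain f1 where f1: "linear f1" "\<And>x. f1 x \<le> q x"
    by (rule sublinear_dominates_linear) blast
  have "f1 x \<le> p1 x" for x
    using f1(2)[of x] lower[of x 0] by (simp add: sublinear_0 p2 linear_0[OF f(1)])
  moreover have "f x - f1 x \<le> p2 x" for x
    using f1(2)[of "- x"] lower[of "- x" x] by (simp add: sublinear_0 p1 linear_neg[OF f1(1)])
  ultimately show ?thesis using that f1(1) by blast
qed

lemma sublinear_norm: "sublinear (norm :: 'v::real_normed_vector \<Rightarrow> real)"
  by (rule sublinearI) (auto simp: norm_triangle_ineq)

text \<open>The norm flattened in the direction \<open>x\<close> is at most \<open>- norm x\<close>
  at \<open>- x\<close>, so every linear functional below it attains \<open>norm x\<close> at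
  \<open>x\<close>.\<close>

lemma norming_functional:
  fixes x :: "'v::real_normed_vector"
  obtains g :: "'v \<Rightarrow>\<^sub>L real" where "norm g \<le> 1" "blinfun_apply g x = norm x"
proof -
  obtain f where f: "linear f" "\<And>y. f y \<le> flatten norm x y"
    using sublinear_dominates_linear[OF sublinear_flatten[OF sublinear_norm]] by blast
  have le: "f y \<le> norm y" for y
    using f(2)[of y] flatten_le[OF sublinear_norm, of 0 x y] by simp
  have abs_le: "\<bar>f y\<bar> \<le> norm y" for y
    using le[of y] le[of "- y"] linear_neg[OF f(1), of y] by simp
  have "f x = norm x"
    using f(2)[of "- x"] flatten_le[OF sublinear_norm, of 1 x "- x"] linear_neg[OF f(1), of x] le[of x]
    by simp
  moreover have bl: "bounded_linear f"
    using f(1) abs_le by (intro bounded_linear_intro[of _ 1]) (auto simp: linear_add linear_cmul)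
  moreover have "norm (Blinfun f) \<le> 1"
    using abs_le by (intro norm_blinfun_bound) (simp_all add: bounded_linear_Blinfun_apply[OF bl])
  ultimately show ?thesis
    using that[of "Blinfun f"] by (simp add: bounded_linear_Blinfun_apply)
qed

section \<open>The weak* topology\<close>

lemma closedin_weak_star_vimage:
  assumes "closed S"
  shows "closedin strong_operator_topology {g. blinfun_apply g x \<in> S}"
  using closedin_continuous_map_preimage[OF strong_operator_topology_continuous_evaluation, of S x] assms
  by (simp add: strong_operator_topology_topspace)

lemma norm_blinfun_le_iff:
  assumes "0 \<le> r" shows "norm g \<le> r \<longleftrightarrow> (\<forall>x. norm (blinfun_apply g x) \<le> r * norm x)"
proof
  assume "norm g \<le> r"
  then show "\<forall>x. norm (blinfun_apply g x) \<le> r * norm x"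
    using norm_blinfun by (metis mult_right_mono norm_ge_zero order_trans)
qed (use assms norm_blinfun_bound in blast)

text \<open>Banach-Alaoglu: inside the compact product of the intervals
  \<open>{- norm x .. norm x}\<close> the linear functions form a closed set \<open>L\<close>.
  \<open>Blinfun\<close> is meaningful on \<open>L\<close> and continuous there, both topologies
  being pointwise.\<close>

theorem weak_star_compact_ball:
  "compactin strong_operator_topology {g :: 'v::real_normed_vector \<Rightarrow>\<^sub>L real. norm g \<le> 1}"
proof -
  define K where "K = Pi\<^sub>E UNIV (\<lambda>x::'v. {- norm x .. norm x})"
  define L where "L = {f \<in> K. linear f}"
  have "compactin euclidean K"
    unfolding K_def by (subst euclidean_product_topology[symmetric], subst compactin_PiE) simp
  then have "compact K" by simp
  have ev: "continuous_on UNIV (\<lambda>f::'v \<Rightarrow> real. f x)" for x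
    by (rule continuous_on_product_coordinates)
  have "{f::'v \<Rightarrow> real. linear f}
      = {f. (\<forall>x y. f (x + y) = f x + f y) \<and> (\<forall>c x. f (c *\<^sub>R x) = c * f x)}"
    by (auto simp: linear_iff)
  also have "closed \<dots>"
    by (intro closed_Collect_conj closed_Collect_all closed_Collect_eq continuous_intros ev)
  finally have "compact L"
    unfolding L_def Collect_conj_eq using \<open>compact K\<close> by (simp add: compact_Int_closed)
  have bl: "bounded_linear f" if "f \<in> L" for f
  proof (rule bounded_linear_intro[of _ 1])
    show "norm (f x) \<le> norm x * 1" for x
      using that by (auto simp: L_def K_def PiE_def Pi_def abs_le_iff) (metis minus_le_iff)
  qed (use that in \<open>auto simp: L_def linear_iff\<close>)
  have "continuous_map (top_of_set L) strong_operator_topology Blinfun"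
    unfolding continuous_on_strong_operator_topo_iff_coordinatewise
  proof
    fix x
    have "continuous_map (top_of_set L) euclidean (\<lambda>f. f x)"
      using continuous_on_subset[OF ev, of L x] by simp
    then show "continuous_map (top_of_set L) euclidean (\<lambda>f. blinfun_apply (Blinfun f) x)"
      by (rule continuous_map_eq) (simp add: bounded_linear_Blinfun_apply bl)
  qed
  then have "compactin strong_operator_topology (Blinfun ` L)"
    using \<open>compact L\<close> by (intro image_compactin[of "top_of_set L"]) (simp_all add: compactin_subtopology)
  moreover have "Blinfun ` L = {g. norm g \<le> 1}"
  proof (intro set_eqI iffI)
    fix g assume "g \<in> Blinfun ` L"
    then obtain f where "f \<in> L" "g = Blinfun f" by blast
    then show "g \<in> {g. norm g \<le> 1}"
      by (auto simp: norm_blinfun_le_iff bounded_linear_Blinfun_apply bl)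
        (auto simp: L_def K_def PiE_def Pi_def abs_le_iff minus_le_iff)
  next
    fix g :: "'v \<Rightarrow>\<^sub>L real" assume "g \<in> {g. norm g \<le> 1}"
    then have "\<bar>blinfun_apply g x\<bar> \<le> norm x" for x
      by (simp add: norm_blinfun_le_iff)
    then have "blinfun_apply g \<in> L"
      using bounded_linear.linear[OF blinfun.bounded_linear_right[of g]]
      by (simp add: L_def K_def PiE_def Pi_def abs_le_iff minus_le_iff)
    moreover have "g = Blinfun (blinfun_apply g)" by (simp add: blinfun_apply_inverse)
    ultimately show "g \<in> Blinfun ` L" by blast
  qed
  ultimately show ?thesis by simp
qed

text \<open>The evaluations are split off one at a time. The part of \<open>\<psi>\<close> dominated
  by \<open>C * \<bar>g x0\<bar>\<close> vanishes with \<open>g x0\<close>, hence is a multiple of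
  the evaluation at \<open>x0\<close>; the rest obeys the hypothesis for the smaller set. The
  \<open>\<epsilon>\<close> term stays with the rest and becomes the final error.\<close>

lemma functional_near_evaluation:
  fixes \<psi> :: "('v::real_normed_vector \<Rightarrow>\<^sub>L real) \<Rightarrow> real"
  assumes "finite F" "linear \<psi>" "C \<ge> 0" "\<epsilon> \<ge> 0"
    and "\<And>g. \<psi> g \<le> C * (\<Sum>x\<in>F. \<bar>blinfun_apply g x\<bar>) + \<epsilon> * norm g"
  shows "\<exists>x. \<forall>g. \<psi> g - blinfun_apply g x \<le> \<epsilon> * norm g"
  using assms(1,2,5)
proof (induction F arbitrary: \<psi> rule: finite_induct)
  case empty
  then show ?case by (intro exI[of _ 0]) (simp add: blinfun.zero_right)
next
  case (insert x0 F)
  define p1 p2 where "p1 g = C * \<bar>blinfun_apply g x0\<bar>"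
    and "p2 g = C * (\<Sum>x\<in>F. \<bar>blinfun_apply g x\<bar>) + \<epsilon> * norm g" for g :: "'v \<Rightarrow>\<^sub>L real"
  have "sublinear p1"
  proof (rule sublinearI)
    show "p1 (g + h) \<le> p1 g + p1 h" for g h
      using assms(3) by (simp add: p1_def blinfun.add_left abs_triangle_ineq mult_left_mono flip: distrib_left)
  qed (simp_all add: p1_def blinfun.scaleR_left abs_mult blinfun.zero_left)
  moreover have "sublinear p2"
  proof (rule sublinearI)
    fix g h :: "'v \<Rightarrow>\<^sub>L real"
    have "(\<Sum>x\<in>F. \<bar>blinfun_apply (g + h) x\<bar>) \<le> (\<Sum>x\<in>F. \<bar>blinfun_apply g x\<bar>) + (\<Sum>x\<in>F. \<bar>blinfun_apply h x\<bar>)"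
      unfolding sum.distrib[symmetric] by (intro sum_mono) (simp add: blinfun.add_left abs_triangle_ineq)
    then have "C * (\<Sum>x\<in>F. \<bar>blinfun_apply (g + h) x\<bar>)
        \<le> C * ((\<Sum>x\<in>F. \<bar>blinfun_apply g x\<bar>) + (\<Sum>x\<in>F. \<bar>blinfun_apply h x\<bar>))"
      using assms(3) by (rule mult_left_mono)
    moreover have "\<epsilon> * norm (g + h) \<le> \<epsilon> * (norm g + norm h)"
      using assms(4) by (intro mult_left_mono norm_triangle_ineq)
    ultimately show "p2 (g + h) \<le> p2 g + p2 h" by (simp add: p2_def algebra_simps)
  qed (simp_all add: p2_def blinfun.scaleR_left abs_mult blinfun.zero_left sum_distrib_left algebra_simps)
  moreover have "\<psi> g \<le> p1 g + p2 g" for g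
    using insert.prems(2)[of g] insert.hyps by (simp add: p1_def p2_def algebra_simps)
  ultimately obtain f1 where f1: "linear f1" "\<And>g. f1 g \<le> p1 g" "\<And>g. \<psi> g - f1 g \<le> p2 g"
    using linear_dominated_split[of p1 p2 \<psi>] insert.prems(1) by blast
  have ker: "f1 g = 0" if "blinfun_apply g x0 = 0" for g
    using f1(2)[of g] f1(2)[of "- g"] that by (simp add: p1_def linear_neg[OF f1(1)] blinfun.minus_left)
  obtain c where c: "\<And>g. f1 g = c * blinfun_apply g x0"
  proof (cases "\<exists>g :: 'v \<Rightarrow>\<^sub>L real. blinfun_apply g x0 \<noteq> 0")
    case True
    then obtain k :: "'v \<Rightarrow>\<^sub>L real" where k: "blinfun_apply k x0 \<noteq> 0" by blast
    have "f1 g = f1 k / blinfun_apply k x0 * blinfun_apply g x0" for g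
    proof -
      have "f1 (g - (blinfun_apply g x0 / blinfun_apply k x0) *\<^sub>R k) = 0"
        using k by (intro ker) (simp add: blinfun.diff_left blinfun.scaleR_left)
      then show ?thesis by (simp add: linear_diff[OF f1(1)] linear_cmul[OF f1(1)])
    qed
    then show ?thesis by (rule that)
  next
    case False
    then show ?thesis using that[of 0] ker by simp
  qed
  have "\<exists>x. \<forall>g. (\<psi> g - f1 g) - blinfun_apply g x \<le> \<epsilon> * norm g"
    using f1(3) by (intro insert.IH linear_compose_sub insert.prems f1(1)) (simp add: p2_def)
  then obtain x where "\<And>g. (\<psi> g - f1 g) - blinfun_apply g x \<le> \<epsilon> * norm g" by blast
  then show ?case
    by (intro exI[of _ "x + c *\<^sub>R x0"]) (simp add: c blinfun.add_right blinfun.scaleR_right algebra_simps)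
qed

text \<open>
  Grothendieck's completeness theorem: off the part dominated by finitely many evaluations the
  functional has norm at most \<open>\<epsilon>\<close>, and the approximating points converge since \<open>'v\<close> is complete.
\<close>

theorem weak_star_continuous_on_ball_imp_evaluation:
  fixes \<psi> :: "('v::banach \<Rightarrow>\<^sub>L real) \<Rightarrow> real"
  assumes lin: "linear \<psi>" and bound: "\<And>g. \<bar>\<psi> g\<bar> \<le> K * norm g"
    and cont: "\<And>\<epsilon>. \<epsilon> > 0 \<Longrightarrow> \<exists>F. finite F \<and>
      (\<forall>g. norm g \<le> 1 \<longrightarrow> (\<forall>x\<in>F. \<bar>blinfun_apply g x\<bar> \<le> 1) \<longrightarrow> \<bar>\<psi> g\<bar> \<le> \<epsilon>)"
  obtains x where "\<And>g. \<psi> g = blinfun_apply g x"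
proof -
  have "\<exists>x. \<forall>g. \<bar>\<psi> g - blinfun_apply g x\<bar> \<le> \<epsilon> * norm g" if \<epsilon>: "\<epsilon> > 0" for \<epsilon>
  proof -
    obtain F where F: "finite F"
      "\<And>g. norm g \<le> 1 \<Longrightarrow> (\<forall>x\<in>F. \<bar>blinfun_apply g x\<bar> \<le> 1) \<Longrightarrow> \<bar>\<psi> g\<bar> \<le> \<epsilon>"
      using cont[OF \<epsilon>] by blast
    \<comment> \<open>If all evaluations are at most \<open>norm g\<close>, normalising
      \<open>g\<close> puts it into the neighbourhood given by \<open>F\<close>. Otherwise a single
      evaluation exceeds \<open>norm g\<close> and pays for \<open>K * norm g\<close>.\<close>
    have "\<psi> g \<le> \<bar>K\<bar> * (\<Sum>x\<in>F. \<bar>blinfun_apply g x\<bar>) + \<epsilon> * norm g" for g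
    proof (cases "\<forall>x\<in>F. \<bar>blinfun_apply g x\<bar> \<le> norm g")
      case True
      have sum: "0 \<le> \<bar>K\<bar> * (\<Sum>x\<in>F. \<bar>blinfun_apply g x\<bar>)"
        by (intro mult_nonneg_nonneg sum_nonneg) auto
      show ?thesis
      proof (cases "g = 0")
        case True
        then show ?thesis using sum by (simp add: linear_0[OF lin])
      next
        case False
        then have "\<bar>\<psi> (inverse (norm g) *\<^sub>R g)\<bar> \<le> \<epsilon>"
          using True by (intro F(2)) (auto simp: blinfun.scaleR_left abs_mult field_simps)
        then have "\<bar>\<psi> g\<bar> \<le> \<epsilon> * norm g"
          using False by (simp add: linear_cmul[OF lin] abs_mult field_simps)
        then show ?thesis using sum by linarith
      qed
    next
      case False
      then obtain x where x: "x \<in> F" "norm g \<le> \<bar>blinfun_apply g x\<bar>" by force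
      have "\<psi> g \<le> K * norm g" using bound[of g] by linarith
      also have "\<dots> \<le> \<bar>K\<bar> * norm g" by (simp add: mult_right_mono)
      also have "\<dots> \<le> \<bar>K\<bar> * \<bar>blinfun_apply g x\<bar>" using x by (simp add: mult_left_mono)
      also have "\<dots> \<le> \<bar>K\<bar> * (\<Sum>x\<in>F. \<bar>blinfun_apply g x\<bar>)"
        using F(1) x(1) by (intro mult_left_mono member_le_sum) auto
      finally show ?thesis using \<epsilon> norm_ge_zero[of g] by (smt (verit) mult_nonneg_nonneg)
    qed
    then obtain x where x: "\<And>g. \<psi> g - blinfun_apply g x \<le> \<epsilon> * norm g"
      using functional_near_evaluation[OF F(1) lin, of "\<bar>K\<bar>" \<epsilon>] \<epsilon> by auto
    have "\<bar>\<psi> g - blinfun_apply g x\<bar> \<le> \<epsilon> * norm g" for g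
      using x[of g] x[of "- g"] by (simp add: linear_neg[OF lin] blinfun.minus_left)
    then show ?thesis by blast
  qed
  then have "\<exists>x. \<forall>g. \<bar>\<psi> g - blinfun_apply g x\<bar> \<le> inverse (real (Suc n)) * norm g" for n
    by simp
  then obtain X where X: "\<And>n g. \<bar>\<psi> g - blinfun_apply g (X n)\<bar> \<le> inverse (real (Suc n)) * norm g"
    by metis
  \<comment> \<open>A norming functional for \<open>X m - X n\<close> turns the estimates on
    functionals into an estimate between the points.\<close>
  have "norm (X m - X n) \<le> inverse (real (Suc m)) + inverse (real (Suc n))" for m n
  proof -
    obtain g where g: "norm g \<le> 1" "blinfun_apply g (X m - X n) = norm (X m - X n)"
      by (rule norming_functional)
    have "norm (X m - X n) \<le> inverse (real (Suc m)) * norm g + inverse (real (Suc n)) * norm g"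
      using X[of g m] X[of g n] unfolding g(2)[symmetric] blinfun.diff_right by linarith
    also have "\<dots> \<le> inverse (real (Suc m)) * 1 + inverse (real (Suc n)) * 1"
      using g(1) by (intro add_mono mult_left_mono) auto
    finally show ?thesis by simp
  qed
  note close = this
  have "Cauchy X"
  proof (rule metric_CauchyI)
    fix \<epsilon> :: real assume "\<epsilon> > 0"
    then obtain N where N: "inverse (real (Suc N)) < \<epsilon> / 2"
      using reals_Archimedean[of "\<epsilon> / 2"] by auto
    have "dist (X m) (X n) < \<epsilon>" if "m \<ge> N" "n \<ge> N" for m n
    proof -
      have "inverse (real (Suc m)) \<le> inverse (real (Suc N))" "inverse (real (Suc n)) \<le> inverse (real (Suc N))"
        using that by (auto intro!: le_imp_inverse_le)
      then show ?thesis using close[of m n] N unfolding dist_norm by linarith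
    qed
    then show "\<exists>M. \<forall>m\<ge>M. \<forall>n\<ge>M. dist (X m) (X n) < \<epsilon>" by blast
  qed
  then obtain x where x: "X \<longlonglongrightarrow> x" by (auto simp: Cauchy_convergent_iff convergent_def)
  have "\<psi> g = blinfun_apply g x" for g
  proof -
    have "(\<lambda>n. blinfun_apply g (X n)) \<longlonglongrightarrow> blinfun_apply g x"
      by (intro tendsto_intros x)
    moreover have "(\<lambda>n. blinfun_apply g (X n)) \<longlonglongrightarrow> \<psi> g"
    proof (rule LIM_zero_cancel, rule Lim_null_comparison)
      show "\<forall>\<^sub>F n in sequentially. norm (blinfun_apply g (X n) - \<psi> g) \<le> inverse (real (Suc n)) * norm g"
        using X by (simp add: abs_minus_commute)
      show "(\<lambda>n. inverse (real (Suc n)) * norm g) \<longlonglongrightarrow> 0"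
        using tendsto_mult_right[OF LIMSEQ_inverse_real_of_nat, of "norm g"] by simp
    qed
    ultimately show ?thesis by (rule LIMSEQ_unique[symmetric])
  qed
  then show ?thesis using that by blast
qed

section \<open>M-summands of dual spaces are weak*-closed\<close>

text \<open>\<open>norm_max\<close> says that the dual is the \<open>\<ell>\<close>-infinity sum of
  the range and the kernel of \<open>R\<close>. No weak* continuity is assumed; it is the conclusion
  of \<open>evaluation\<close>.\<close>

locale m_projection =
  fixes R :: "('v::banach \<Rightarrow>\<^sub>L real) \<Rightarrow> ('v \<Rightarrow>\<^sub>L real)"
  assumes linear: "linear R" and idem: "R (R g) = R g"
    and norm_max: "norm g = max (norm (R g)) (norm (g - R g))"
begin

text \<open>
  The unit ball of the range consists of the \<open>g\<close> that remain in the unit ball after adding any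
  element of the unit ball of the kernel, which is a weak*-closed condition.
\<close>

lemma closed_ball_range:
  "closedin strong_operator_topology {g. norm g \<le> 1 \<and> R g = g}"
proof -
  have eq: "{g. norm g \<le> 1 \<and> R g = g} = (\<Inter>b\<in>{b. norm b \<le> 1 \<and> R b = 0}. \<Inter>x.
      {g. blinfun_apply g x \<in> {- norm x - blinfun_apply b x .. norm x - blinfun_apply b x}})"
    (is "?A = ?B")
  proof -
    have "norm (g + b) \<le> 1 \<longleftrightarrow>
        (\<forall>x. blinfun_apply g x \<in> {- norm x - blinfun_apply b x .. norm x - blinfun_apply b x})" for g b
    proof -
      have "norm (g + b) \<le> 1 \<longleftrightarrow> (\<forall>x. \<bar>blinfun_apply g x + blinfun_apply b x\<bar> \<le> norm x)"
        by (simp add: norm_blinfun_le_iff blinfun.add_left)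
      also have "\<dots> \<longleftrightarrow> (\<forall>x. blinfun_apply g x
          \<in> {- norm x - blinfun_apply b x .. norm x - blinfun_apply b x})"
        by (intro iff_allI) auto
      finally show ?thesis .
    qed
    then have "?B = {g. \<forall>b. norm b \<le> 1 \<longrightarrow> R b = 0 \<longrightarrow> norm (g + b) \<le> 1}"
      by blast
    also have "\<dots> = ?A"
    proof (intro set_eqI iffI)
      fix g assume "g \<in> ?A"
      then show "g \<in> {g. \<forall>b. norm b \<le> 1 \<longrightarrow> R b = 0 \<longrightarrow> norm (g + b) \<le> 1}"
        using norm_max[of "g + b" for b] by (auto simp: linear_add[OF linear])
    next
      fix g assume "g \<in> {g. \<forall>b. norm b \<le> 1 \<longrightarrow> R b = 0 \<longrightarrow> norm (g + b) \<le> 1}"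
      then have g: "\<And>b. norm b \<le> 1 \<Longrightarrow> R b = 0 \<Longrightarrow> norm (g + b) \<le> 1" by blast
      define c where "c = g - R g"
      have Rc: "R c = 0" by (simp add: c_def linear_diff[OF linear] idem)
      have "c = 0"
      proof (rule ccontr)
        assume c: "c \<noteq> 0"
        \<comment> \<open>Adding a unit vector in the direction of the kernel component
          \<open>c\<close> makes its norm \<open>norm c + 1\<close>, which no element of the ball
          allows.\<close>
        define b where "b = inverse (norm c) *\<^sub>R c"
        have b: "norm b = 1" "R b = 0"
          using c Rc by (simp_all add: b_def linear_cmul[OF linear])
        have "norm (c + b) \<le> norm (g + b)"
          using norm_max[of "g + b"] b(2) by (simp add: linear_add[OF linear] c_def algebra_simps)
        also have "\<dots> \<le> 1" using g b by simp
        finally have "norm (c + b) \<le> 1" .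
        moreover have "norm (c + b) = norm c + 1"
        proof -
          have "c + b = (1 + inverse (norm c)) *\<^sub>R c" by (simp add: b_def scaleR_left_distrib)
          then have "norm (c + b) = (1 + inverse (norm c)) * norm c" by simp
          then show ?thesis using c by (simp add: distrib_right)
        qed
        ultimately show False using c by simp
      qed
      then show "g \<in> ?A" using g[of 0] by (simp add: c_def linear_0[OF linear])
    qed
    finally show ?thesis by simp
  qed
  have ne: "{b. norm b \<le> 1 \<and> R b = 0} \<noteq> {}"
    using linear_0[OF linear] by (auto intro: exI[of _ 0])
  show ?thesis
    unfolding eq
    by (intro closedin_INT ne closedin_weak_star_vimage closed_atLeastAtMost UNIV_not_empty)
qed

lemma complement: "m_projection (\<lambda>g. g - R g)"
proof (rule m_projection.intro)
  show "linear (\<lambda>g. g - R g)"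
    by (intro linear_compose_sub linear_ident linear)
  show "(g - R g) - R (g - R g) = g - R g" for g
    by (simp add: linear_diff[OF linear] idem)
  show "norm g = max (norm (g - R g)) (norm (g - (g - R g)))" for g
    using norm_max[of g] by (simp only: diff_diff_eq2 add_diff_cancel_left' max.commute)
qed

text \<open>Weak* continuity of \<open>R\<close> on the unit ball by compactness. Pairs in
  \<open>B1 \<times> B2\<close> whose first entry is not small at \<open>x\<close> form a compact
  set on which the sum never vanishes, so finitely many points \<open>u\<close> detect this. Applied
  to \<open>(R g, g - R g)\<close>: if \<open>g\<close> is small at these points, \<open>R g\<close>
  is small at \<open>x\<close>.\<close>

lemma evaluation:
  obtains y where "\<And>g. blinfun_apply (R g) x = blinfun_apply g y"
proof -
  let ?W = "strong_operator_topology :: ('v \<Rightarrow>\<^sub>L real) topology"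
  interpret c: m_projection "\<lambda>g. g - R g" by (rule complement)
  define B1 B2 where "B1 = {g. norm g \<le> 1 \<and> R g = g}" and "B2 = {g. norm g \<le> 1 \<and> R g = 0}"
  have compact: "compactin ?W B1" "compactin ?W B2"
    using closed_compactin[OF weak_star_compact_ball _ closed_ball_range]
      closed_compactin[OF weak_star_compact_ball _ c.closed_ball_range]
    by (auto simp: B1_def B2_def algebra_simps)
  have ev: "continuous_map (prod_topology ?W ?W) euclideanreal (\<lambda>p. blinfun_apply (fst p) u)"
    "continuous_map (prod_topology ?W ?W) euclideanreal (\<lambda>p. blinfun_apply (snd p) u)" for u
    using continuous_map_compose[OF continuous_map_fst strong_operator_topology_continuous_evaluation]
      continuous_map_compose[OF continuous_map_snd strong_operator_topology_continuous_evaluation]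
    by (auto simp: o_def)
  have norm_R: "norm (R g) \<le> norm g" "norm (g - R g) \<le> norm g" for g
    using norm_max[of g] by auto
  have cont: "\<exists>F. finite F \<and> (\<forall>g. norm g \<le> 1 \<longrightarrow> (\<forall>u\<in>F. \<bar>blinfun_apply g u\<bar> \<le> 1) \<longrightarrow>
      \<bar>blinfun_apply (R g) x\<bar> \<le> \<epsilon>)" if \<epsilon>: "\<epsilon> > 0" for \<epsilon>
  proof -
    define D :: "(('v \<Rightarrow>\<^sub>L real) \<times> ('v \<Rightarrow>\<^sub>L real)) set" where "D = {p. blinfun_apply (fst p) x \<in> - {- \<epsilon> <..< \<epsilon>}}"
    define V :: "'v \<Rightarrow> (('v \<Rightarrow>\<^sub>L real) \<times> ('v \<Rightarrow>\<^sub>L real)) set"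
      where "V u = {p. blinfun_apply (fst p) u + blinfun_apply (snd p) u \<in> - {-1..1}}" for u
    have "closedin (prod_topology ?W ?W) D"
      using closedin_continuous_map_preimage[OF ev(1), of "- {- \<epsilon> <..< \<epsilon>}" x]
      by (simp add: D_def strong_operator_topology_topspace closed_Compl)
    then have "compactin (prod_topology ?W ?W) ((B1 \<times> B2) \<inter> D)"
      using compact by (intro compact_Int_closedin) (auto simp: compactin_Times)
    moreover have "openin (prod_topology ?W ?W) (V u)" for u
      using openin_continuous_map_preimage[OF continuous_map_add[OF ev], of "- {-1..1}" u u]
      by (simp add: V_def strong_operator_topology_topspace open_Compl)
    moreover have "(B1 \<times> B2) \<inter> D \<subseteq> (\<Union>u. V u)"
    proof
      fix p assume p: "p \<in> (B1 \<times> B2) \<inter> D"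
      have "fst p + snd p \<noteq> 0"
      proof
        assume "fst p + snd p = 0"
        then have "R (fst p + snd p) = 0" by (simp add: linear_0[OF linear])
        then have "fst p = 0"
          using p by (auto simp: B1_def B2_def linear_add[OF linear])
        then show False using p \<epsilon> by (auto simp: D_def blinfun.zero_left)
      qed
      then obtain u where u: "blinfun_apply (fst p + snd p) u \<noteq> 0"
        by (metis blinfun_eqI blinfun.zero_left)
      define s where "s = blinfun_apply (fst p + snd p) u"
      \<comment> \<open>Rescaling \<open>u\<close> makes the value 2, safely outside
        \<open>{-1..1}\<close>.\<close>
      have "blinfun_apply (fst p + snd p) ((2 / s) *\<^sub>R u) = 2"
        using u by (simp add: s_def blinfun.scaleR_right)
      then have "p \<in> V ((2 / s) *\<^sub>R u)"
        unfolding blinfun.add_left by (simp add: V_def)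
      then show "p \<in> (\<Union>u. V u)" by blast
    qed
    ultimately have "\<exists>\<F>. finite \<F> \<and> \<F> \<subseteq> range V \<and> (B1 \<times> B2) \<inter> D \<subseteq> \<Union> \<F>"
      unfolding compactin_def by (metis (no_types, lifting) rangeE)
    then obtain F where F: "finite F" "(B1 \<times> B2) \<inter> D \<subseteq> (\<Union>u\<in>F. V u)"
      by (metis finite_subset_image)
    have "\<bar>blinfun_apply (R g) x\<bar> \<le> \<epsilon>" if g: "norm g \<le> 1" "\<forall>u\<in>F. \<bar>blinfun_apply g u\<bar> \<le> 1" for g
    proof (rule ccontr)
      assume "\<not> \<bar>blinfun_apply (R g) x\<bar> \<le> \<epsilon>"
      moreover have "R g \<in> B1" "g - R g \<in> B2"
        using g(1) norm_R[of g] by (auto simp: B1_def B2_def idem linear_diff[OF linear])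
      ultimately have "(R g, g - R g) \<in> (B1 \<times> B2) \<inter> D"
        by (auto simp: D_def)
      then obtain u where "u \<in> F" "(R g, g - R g) \<in> V u" using F(2) by blast
      then show False using g(2) by (auto simp: V_def blinfun.diff_left abs_le_iff)
    qed
    then show ?thesis using F(1) by blast
  qed
  have lin: "linear (\<lambda>g. blinfun_apply (R g) x)"
    by (rule linearI) (simp_all add: linear_add[OF linear] linear_cmul[OF linear] blinfun.add_left blinfun.scaleR_left)
  have bound: "\<bar>blinfun_apply (R g) x\<bar> \<le> norm x * norm g" for g
  proof -
    have "\<bar>blinfun_apply (R g) x\<bar> \<le> norm (R g) * norm x"
      using norm_blinfun[of "R g" x] by simp
    also have "\<dots> \<le> norm g * norm x" using norm_R[of g] by (simp add: mult_right_mono)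
    finally show ?thesis by (simp add: mult.commute)
  qed
  show ?thesis
    using weak_star_continuous_on_ball_imp_evaluation[OF lin bound cont] that by blast
qed

text \<open>\<open>Y\<close> is the preadjoint of \<open>R\<close>, and the range of
  \<open>R\<close> is the annihilator of the vectors \<open>Y x - x\<close>.\<close>

theorem closedin_range: "closedin strong_operator_topology {g. R g = g}"
proof -
  have "\<forall>x. \<exists>y. \<forall>g. blinfun_apply (R g) x = blinfun_apply g y"
  proof
    fix x
    obtain y where "\<And>g. blinfun_apply (R g) x = blinfun_apply g y"
      using evaluation[of x] by blast
    then show "\<exists>y. \<forall>g. blinfun_apply (R g) x = blinfun_apply g y" by blast
  qed
  then obtain Y where Y: "\<And>x g. blinfun_apply (R g) x = blinfun_apply g (Y x)"
    using choice[of "\<lambda>x y. \<forall>g. blinfun_apply (R g) x = blinfun_apply g y"] by blast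
  have "{g. R g = g} = (\<Inter>x. {g. blinfun_apply g (Y x - x) \<in> {0}})"
  proof -
    have "R g = g \<longleftrightarrow> (\<forall>x. blinfun_apply g (Y x - x) = 0)" for g
      unfolding blinfun.diff_right Y[symmetric] by (auto intro: blinfun_eqI)
    then show ?thesis by auto
  qed
  then show ?thesis
    by (simp only:) (intro closedin_INT closedin_weak_star_vimage closed_singleton UNIV_not_empty)
qed

end

section \<open>Unital JB-algebras and their order\<close>

locale unital_jb_algebra = jb_algebra jp
  for jp :: "'a::banach \<Rightarrow> 'a \<Rightarrow> 'a"  (infixl "\<odot>" 70) +
  fixes e :: 'a
  assumes unit_element: "is_unit_element jp e"
begin

lemma bounded_bilinear_product: "bounded_bilinear (\<odot>)"
proof (intro bounded_bilinear.intro exI[of _ 1])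
qed (use bilinear norm_prod_le in
      \<open>auto simp: bilinear_ladd bilinear_radd bilinear_lmul bilinear_rmul\<close>)

sublocale jp: bounded_bilinear "(\<odot>)"
  by (rule bounded_bilinear_product)

lemmas distribs = jp.add_left jp.add_right jp.diff_left jp.diff_right

lemma unit_left [simp]: "e \<odot> x = x" and unit_right [simp]: "x \<odot> e = x"
  using unit_element by (auto simp: is_unit_element_def)

text \<open>Only an inequality, because in the zero algebra \<open>e = 0\<close>.\<close>

lemma norm_unit_le: "norm e \<le> 1"
proof -
  have "norm e = norm e * norm e"
    using norm_square[of e] by (simp add: power2_eq_square)
  then show ?thesis by auto
qed

abbreviation P :: "'a set" where "P \<equiv> pos_cone (\<odot>)"
abbreviation le :: "'a \<Rightarrow> 'a \<Rightarrow> bool"  (infix "\<preceq>" 50) where "x \<preceq> y \<equiv> jb_le (\<odot>) x y"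

lemma le_iff: "x \<preceq> y \<longleftrightarrow> y - x \<in> P"
  by (simp add: jb_le_def)

lemma square_in_P [simp]: "x \<odot> x \<in> P"
  by (auto simp: pos_cone_def)

lemma P_cases: assumes "u \<in> P" obtains a where "u = a \<odot> a"
  using assms by (auto simp: pos_cone_def)

lemma zero_in_P [simp]: "0 \<in> P"
  using square_in_P[of 0] by (simp add: jp.zero_left)

lemma unit_in_P [simp]: "e \<in> P"
  using square_in_P[of e] by simp

lemma norm_le_norm_add:
  assumes "u \<in> P" "v \<in> P" shows "norm u \<le> norm (u + v)"
  using assms norm_square_le by (auto elim!: P_cases)

lemma norm_square_le_1: "norm x \<le> 1 \<Longrightarrow> norm (x \<odot> x) \<le> 1"
  by (simp add: norm_square power_le_one)

section \<open>Square roots and the cone\<close>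

text \<open>
  The iterates of \<open>b \<mapsto> (x + b\<^sup>2) / 2\<close> converge because they are majorised by the
  iterates of the same map for the number 1; the limit satisfies \<open>(e - b)\<^sup>2 = e - x\<close>.
\<close>

lemma square_root_exists:
  assumes x: "norm x \<le> 1" "x \<in> A" and e: "e \<in> A"
    and A: "closed A" "subspace A" "\<And>u. u \<in> A \<Longrightarrow> u \<odot> u \<in> A"
  obtains b where "b \<in> A" "b \<odot> b = e - x"
proof -
  define b where "b = rec_nat 0 (\<lambda>_ b. (1/2) *\<^sub>R (x + b \<odot> b))"
  define \<beta> :: "nat \<Rightarrow> real" where "\<beta> = rec_nat 0 (\<lambda>_ b. (1/2) * (1 + b * b))"
  have b0: "b 0 = 0" and bS: "b (Suc n) = (1/2) *\<^sub>R (x + b n \<odot> b n)" for n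
    by (simp_all add: b_def)
  have \<beta>0: "\<beta> 0 = 0" and \<beta>S: "\<beta> (Suc n) = (1/2) * (1 + \<beta> n * \<beta> n)" for n
    by (simp_all add: \<beta>_def)
  have \<beta>: "0 \<le> \<beta> n \<and> \<beta> n \<le> 1" for n
    by (induction n) (auto simp: \<beta>0 \<beta>S mult_le_one)
  have nb: "norm (b n) \<le> \<beta> n" for n
  proof (induction n)
    case (Suc n)
    have "norm (b n \<odot> b n) \<le> \<beta> n * \<beta> n"
      using norm_prod_le[of "b n" "b n"] mult_mono[OF Suc Suc] \<beta>[of n] by auto
    then show ?case
      using norm_triangle_ineq[of x "b n \<odot> b n"] x by (simp add: bS \<beta>S)
  qed (simp add: b0 \<beta>0)
  have step: "norm (b (Suc n) - b n) \<le> \<beta> (Suc n) - \<beta> n" for n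
  proof (induction n)
    case 0
    show ?case using x by (simp add: b0 bS \<beta>0 \<beta>S jp.zero_left)
  next
    case (Suc n)
    \<comment> \<open>The difference of two squares factors by commutativity alone, so the estimate
      copies the scalar recursion for \<open>\<beta>\<close>.\<close>
    have "b (Suc (Suc n)) - b (Suc n)
        = (1/2) *\<^sub>R ((b (Suc n) - b n) \<odot> (b (Suc n) + b n))"
    proof -
      have "b (Suc (Suc n)) - b (Suc n) = (1/2) *\<^sub>R (b (Suc n) \<odot> b (Suc n) - b n \<odot> b n)"
        unfolding bS[of "Suc n"] bS[of n] by (simp add: scaleR_right_diff_distrib scaleR_right_distrib)
      then show ?thesis
        by (simp add: distribs commutative[of "b n" "b (Suc n)"])
    qed
    also have "norm \<dots> \<le> (1/2) * (norm (b (Suc n) - b n) * norm (b (Suc n) + b n))"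
      using norm_prod_le by simp
    also have "\<dots> \<le> (1/2) * ((\<beta> (Suc n) - \<beta> n) * (\<beta> (Suc n) + \<beta> n))"
      using Suc norm_triangle_mono[OF nb nb, of "Suc n" n] order_trans[OF norm_ge_zero Suc]
      by (intro mult_left_mono mult_mono) auto
    also have "\<dots> = \<beta> (Suc (Suc n)) - \<beta> (Suc n)"
      unfolding \<beta>S[of "Suc n"] by (simp add: \<beta>S[of n] field_simps)
    finally show ?case .
  qed
  have dist_le: "norm (b (n + k) - b n) \<le> \<beta> (n + k) - \<beta> n" for n k
  proof (induction k)
    case (Suc k)
    show ?case
      using norm_triangle_ineq[of "b (n + Suc k) - b (n + k)" "b (n + k) - b n"]
        step[of "n + k"] Suc by simp
  qed simp
  have dist_le': "norm (b m - b n) \<le> \<bar>\<beta> m - \<beta> n\<bar>" for m n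
  proof (cases "n \<le> m")
    case True
    then show ?thesis using dist_le[of n "m - n"] by simp
  next
    case False
    then show ?thesis using dist_le[of m "n - m"] by (simp add: norm_minus_commute)
  qed
  have "incseq \<beta>"
    using order_trans[OF norm_ge_zero step] by (intro incseq_SucI) simp
  then have "Cauchy \<beta>"
    using \<beta> by (metis convergent_Cauchy convergent_def incseq_convergent)
  then have "Cauchy b"
    unfolding Cauchy_def dist_norm using dist_le' by (metis order_le_less_trans real_norm_def)
  then obtain c where c: "b \<longlonglongrightarrow> c"
    by (auto simp: Cauchy_convergent_iff convergent_def)
  \<comment> \<open>Confining the root to \<open>A\<close> is what later makes it operator commute
    with a given element.\<close>
  have "b n \<in> A" for n
    by (induction n) (auto simp: b0 bS intro: A x subspace_0 subspace_scale subspace_add)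
  then have cA: "c \<in> A"
    using c A(1) closed_sequentially by blast
  have "(\<lambda>n. b (Suc n)) \<longlonglongrightarrow> (1/2) *\<^sub>R (x + c \<odot> c)"
    unfolding bS by (intro tendsto_intros jp.tendsto c)
  then have "c = (1/2) *\<^sub>R (x + c \<odot> c)"
    using c LIMSEQ_unique by (metis LIMSEQ_Suc)
  then have "c + c = x + c \<odot> c"
    by (metis scaleR_half_double scaleR_right_distrib)
  then have "(e - c) \<odot> (e - c) = e - x"
    by (simp add: distribs algebra_simps)
  moreover have "e - c \<in> A"
    using e cA A by (simp add: subspace_diff)
  ultimately show ?thesis using that by blast
qed

lemma in_P_if_norm_le: assumes "norm (e - u) \<le> 1" shows "u \<in> P"
proof -
  obtain b where "b \<odot> b = e - (e - u)"
    using square_root_exists[OF assms, of UNIV] by auto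
  then show ?thesis by (metis diff_diff_eq2 add_diff_cancel_left' square_in_P)
qed

text \<open>Here \<open>e - u\<close> is a square, and adding the positive \<open>u\<close> to it
  can only increase its norm, up to \<open>norm e\<close>.\<close>

lemma norm_le_if_in_P: assumes "u \<in> P" "norm u \<le> 1" shows "norm (e - u) \<le> 1"
proof -
  obtain b where b: "b \<odot> b = e - u"
    using square_root_exists[OF assms(2), of UNIV] by auto
  have "norm (b \<odot> b) \<le> norm (b \<odot> b + u)"
    using assms by (intro norm_le_norm_add) auto
  then show ?thesis using norm_unit_le by (simp add: b)
qed

lemma scaleR_in_P: assumes "0 \<le> c" "u \<in> P" shows "c *\<^sub>R u \<in> P"
proof -
  obtain a where "u = a \<odot> a" using assms(2) by (rule P_cases)
  then have "c *\<^sub>R u = (sqrt c *\<^sub>R a) \<odot> (sqrt c *\<^sub>R a)"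
    using assms(1) by (simp add: jp.scaleR_left jp.scaleR_right)
  then show ?thesis by (metis square_in_P)
qed

lemma in_P_scaleR_iff: "0 < c \<Longrightarrow> c *\<^sub>R u \<in> P \<longleftrightarrow> u \<in> P"
  using scaleR_in_P[of c u] scaleR_in_P[of "inverse c" "c *\<^sub>R u"] by auto

text \<open>A sum of squares is not visibly a square. Instead, positivity of \<open>u\<close> is
  read as \<open>norm (l *\<^sub>R e - u) \<le> l\<close> for some \<open>l \<ge> norm u\<close>,
  and such bounds add up by the triangle inequality. The summand 1 in \<open>l\<close> and
  \<open>m\<close> keeps them positive.\<close>

lemma add_in_P: assumes "u \<in> P" "v \<in> P" shows "u + v \<in> P"
proof -
  define l m where "l = norm u + 1" and "m = norm v + 1"
  have pos: "l > 0" "m > 0" by (simp_all add: l_def m_def add_nonneg_pos)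
  have bound: "norm (l *\<^sub>R e - u) \<le> l" if "l > 0" "norm u \<le> l" "u \<in> P" for l u
  proof -
    have "norm (e - inverse l *\<^sub>R u) \<le> 1"
      using that by (intro norm_le_if_in_P scaleR_in_P) (auto simp: field_simps)
    moreover have "l *\<^sub>R e - u = l *\<^sub>R (e - inverse l *\<^sub>R u)"
      using that by (simp add: scaleR_right_diff_distrib)
    ultimately show ?thesis
      using that by (simp add: mult_left_le)
  qed
  have "norm ((l + m) *\<^sub>R e - (u + v)) \<le> norm (l *\<^sub>R e - u) + norm (m *\<^sub>R e - v)"
    by (rule order_trans[OF _ norm_triangle_ineq]) (simp add: algebra_simps)
  also have "\<dots> \<le> l + m"
    using bound[OF pos(1) _ assms(1)] bound[OF pos(2) _ assms(2)] by (simp add: l_def m_def)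
  finally have *: "norm ((l + m) *\<^sub>R e - (u + v)) \<le> l + m" .
  have "e - inverse (l + m) *\<^sub>R (u + v) = inverse (l + m) *\<^sub>R ((l + m) *\<^sub>R e - (u + v))"
    using pos by (simp add: scaleR_right_diff_distrib)
  then have "norm (e - inverse (l + m) *\<^sub>R (u + v)) = norm ((l + m) *\<^sub>R e - (u + v)) / (l + m)"
    using pos by (simp add: divide_inverse mult.commute)
  also have "\<dots> \<le> 1"
    using * pos by simp
  finally have "inverse (l + m) *\<^sub>R (u + v) \<in> P"
    by (rule in_P_if_norm_le)
  then show ?thesis
    using pos by (simp add: in_P_scaleR_iff)
qed

lemma P_antisym: assumes "u \<in> P" "- u \<in> P" shows "u = 0"
  using norm_le_norm_add[OF assms] by simp

lemma le_refl [simp]: "x \<preceq> x"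
  by (simp add: le_iff)

lemma le_trans [trans]: "x \<preceq> y \<Longrightarrow> y \<preceq> z \<Longrightarrow> x \<preceq> z"
  unfolding le_iff using add_in_P[of "y - x" "z - y"] by simp

lemma le_antisym: "x \<preceq> y \<Longrightarrow> y \<preceq> x \<Longrightarrow> x = y"
  unfolding le_iff using P_antisym[of "y - x"] by simp

lemma unit_minus_in_P: assumes "norm x \<le> 1" shows "e - x \<in> P"
  by (rule in_P_if_norm_le) (simp add: assms)

lemma le_norm_unit: assumes "norm x \<le> c" shows "x \<preceq> c *\<^sub>R e"
proof (cases "c = 0")
  case True
  then show ?thesis using assms by simp
next
  case False
  then have c: "c > 0" using assms by (smt (verit) norm_ge_zero)
  then have "e - inverse c *\<^sub>R x \<in> P"
    using assms by (intro unit_minus_in_P) (simp add: field_simps)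
  then have "c *\<^sub>R (e - inverse c *\<^sub>R x) \<in> P"
    using c by (simp add: scaleR_in_P)
  then show ?thesis using c by (simp add: le_iff scaleR_right_diff_distrib)
qed

section \<open>Power associativity\<close>

text \<open>Subtracting the Jordan identity at \<open>a - c\<close> from that at
  \<open>a + c\<close> leaves the terms odd in \<open>c\<close>; removing the cubic ones leaves
  twice the claim.\<close>

lemma jordan_linearized:
  "c \<odot> (b \<odot> (a \<odot> a)) + (a \<odot> (b \<odot> (a \<odot> c)) + a \<odot> (b \<odot> (a \<odot> c)))
    = (c \<odot> b) \<odot> (a \<odot> a) + ((a \<odot> b) \<odot> (a \<odot> c) + (a \<odot> b) \<odot> (a \<odot> c))"
proof -
  have "((a + c) \<odot> (b \<odot> ((a + c) \<odot> (a + c))) - (a - c) \<odot> (b \<odot> ((a - c) \<odot> (a - c))))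
      - (c \<odot> (b \<odot> (c \<odot> c)) + c \<odot> (b \<odot> (c \<odot> c)))
    = (((a + c) \<odot> b) \<odot> ((a + c) \<odot> (a + c)) - ((a - c) \<odot> b) \<odot> ((a - c) \<odot> (a - c)))
      - ((c \<odot> b) \<odot> (c \<odot> c) + (c \<odot> b) \<odot> (c \<odot> c))"
    by (simp only: jordan_identity)
  then have "2 *\<^sub>R (c \<odot> (b \<odot> (a \<odot> a)) + (a \<odot> (b \<odot> (a \<odot> c)) + a \<odot> (b \<odot> (a \<odot> c))))
     = 2 *\<^sub>R ((c \<odot> b) \<odot> (a \<odot> a) + ((a \<odot> b) \<odot> (a \<odot> c) + (a \<odot> b) \<odot> (a \<odot> c)))"
    unfolding scaleR_2 by (simp add: distribs commutative[of c a] algebra_simps)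
  then show ?thesis by simp
qed

lemma jordan_linearized_full:
  "c \<odot> (b \<odot> (a \<odot> d)) + a \<odot> (b \<odot> (d \<odot> c)) + d \<odot> (b \<odot> (a \<odot> c))
    = (c \<odot> b) \<odot> (a \<odot> d) + (a \<odot> b) \<odot> (d \<odot> c) + (d \<odot> b) \<odot> (a \<odot> c)"
proof -
  let ?l = "\<lambda>a. c \<odot> (b \<odot> (a \<odot> a)) + (a \<odot> (b \<odot> (a \<odot> c)) + a \<odot> (b \<odot> (a \<odot> c)))"
  let ?r = "\<lambda>a. (c \<odot> b) \<odot> (a \<odot> a) + ((a \<odot> b) \<odot> (a \<odot> c) + (a \<odot> b) \<odot> (a \<odot> c))"
  have "?l (a + d) - ?l a - ?l d = ?r (a + d) - ?r a - ?r d"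
    by (simp only: jordan_linearized)
  then have "2 *\<^sub>R (c \<odot> (b \<odot> (a \<odot> d)) + a \<odot> (b \<odot> (d \<odot> c)) + d \<odot> (b \<odot> (a \<odot> c)))
     = 2 *\<^sub>R ((c \<odot> b) \<odot> (a \<odot> d) + (a \<odot> b) \<odot> (d \<odot> c) + (d \<odot> b) \<odot> (a \<odot> c))"
    unfolding scaleR_2 by (simp add: distribs commutative[of d a] algebra_simps)
  then show ?thesis by simp
qed

primrec pow :: "'a \<Rightarrow> nat \<Rightarrow> 'a" where
  "pow x 0 = e"
| "pow x (Suc n) = x \<odot> pow x n"

text \<open>The fully linearized identity writes multiplication by \<open>pow x (n + 2)\<close> as a
  polynomial in the multiplications by \<open>x\<close>, its square, \<open>pow x n\<close> and
  \<open>pow x (n + 1)\<close>, so commutation propagates by a two-step induction.\<close>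

lemma commute_pow:
  assumes T: "linear T" "\<And>w. T (x \<odot> w) = x \<odot> T w" "\<And>w. T ((x \<odot> x) \<odot> w) = (x \<odot> x) \<odot> T w"
  shows "T (pow x n \<odot> w) = pow x n \<odot> T w"
proof (induction n arbitrary: w rule: induct_nat_012)
  case 0
  show ?case by simp
next
  case 1
  show ?case by (simp add: T)
next
  case (ge2 n)
  have expand: "pow x (Suc (Suc n)) \<odot> w = pow x (Suc n) \<odot> (x \<odot> w) + (x \<odot> x) \<odot> (pow x n \<odot> w)
      + pow x (Suc n) \<odot> (x \<odot> w) - x \<odot> (x \<odot> (pow x n \<odot> w)) - pow x n \<odot> (x \<odot> (x \<odot> w))" for w
    using jordan_linearized_full[of w x x "pow x n"]
    by (simp add: commutative[of w] commutative[of "pow x n" x] commutative[of _ "pow x (Suc n)"]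
          commutative[of _ "x \<odot> pow x n"] algebra_simps)
  show ?case
    unfolding expand linear_add[OF T(1)] linear_diff[OF T(1)] T ge2 ..
qed

lemma linear_mult: "linear ((\<odot>) a)"
  using bilinear by (simp add: bilinear_def)

text \<open>\<open>commute_pow\<close> is used twice: with \<open>T\<close> the multiplication by
  \<open>x\<close> or by its square, where the Jordan identity supplies the hypotheses, and then
  with \<open>T\<close> the multiplication by \<open>pow x m\<close>.\<close>

lemma pow_commute: "pow x m \<odot> (pow x n \<odot> w) = pow x n \<odot> (pow x m \<odot> w)"
proof (rule commute_pow[OF linear_mult])
  show "pow x m \<odot> (x \<odot> w) = x \<odot> (pow x m \<odot> w)" for w
    by (rule commute_pow[OF linear_mult, symmetric])
      (use jordan_identity[of x] in \<open>auto simp: commutative\<close>)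
  show "pow x m \<odot> ((x \<odot> x) \<odot> w) = (x \<odot> x) \<odot> (pow x m \<odot> w)" for w
    by (rule commute_pow[OF linear_mult, symmetric])
      (use jordan_identity[of x] in \<open>auto simp: commutative\<close>)
qed

lemma pow_add: "pow x m \<odot> pow x n = pow x (m + n)"
proof (induction m)
  case (Suc m)
  show ?case
    using pow_commute[of x n 1 "pow x m"] Suc by (simp add: commutative)
qed simp

text \<open>An intersection of closed subspaces rather than a closure of polynomials: a property
  that cuts out a closed subspace then has to be checked on powers only.\<close>

definition gen_alg :: "'a \<Rightarrow> 'a set" where
  "gen_alg x = \<Inter> {B. subspace B \<and> closed B \<and> range (pow x) \<subseteq> B}"

lemma gen_alg_least:
  assumes "subspace B" "closed B" "range (pow x) \<subseteq> B" shows "gen_alg x \<subseteq> B"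
  using assms by (auto simp: gen_alg_def)

lemma closed_gen_alg: "closed (gen_alg x)"
  and subspace_gen_alg: "subspace (gen_alg x)"
  and pow_in_gen_alg: "pow x n \<in> gen_alg x"
  by (auto simp: gen_alg_def intro!: subspace_Inter)

lemma closed_vimage_mult: "closed A \<Longrightarrow> closed {u. u \<odot> w \<in> A}"
  using continuous_closed_vimage[of A "\<lambda>u. u \<odot> w"]
  by (auto simp: vimage_def jp.isCont intro!: continuous_intros)

text \<open>Leastness in two rounds: one extends from powers to \<open>u\<close> with a power as the
  other factor, the next from powers to \<open>v\<close> with \<open>u\<close> fixed.
  \<open>gen_alg_commute\<close> has the same shape.\<close>

lemma gen_alg_mult:
  assumes "u \<in> gen_alg x" "v \<in> gen_alg x" shows "u \<odot> v \<in> gen_alg x"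
proof -
  have sub: "subspace {u. u \<odot> w \<in> gen_alg x}" for w
    using subspace_gen_alg[of x]
    by (auto simp: subspace_def jp.add_left jp.scaleR_left jp.zero_left)
  have 1: "gen_alg x \<subseteq> {u. u \<odot> pow x n \<in> gen_alg x}" for n
    by (intro gen_alg_least sub closed_vimage_mult closed_gen_alg)
      (auto simp: pow_add pow_in_gen_alg)
  have "pow x n \<odot> u \<in> gen_alg x" for n
    using 1 assms(1) by (metis (no_types, lifting) commutative mem_Collect_eq subsetD)
  then have "gen_alg x \<subseteq> {v. v \<odot> u \<in> gen_alg x}"
    by (intro gen_alg_least sub closed_vimage_mult closed_gen_alg) auto
  then show ?thesis using assms(2) by (auto simp: commutative)
qed

lemma gen_alg_commute:
  assumes "u \<in> gen_alg x" "v \<in> gen_alg x" shows "u \<odot> (v \<odot> w) = v \<odot> (u \<odot> w)"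
proof -
  have sub: "subspace {u. \<forall>w. u \<odot> (v \<odot> w) = v \<odot> (u \<odot> w)}" for v
    by (auto simp: subspace_def jp.add_left jp.add_right jp.scaleR_left jp.scaleR_right
          jp.zero_left jp.zero_right)
  have cl: "closed {u. \<forall>w. u \<odot> (v \<odot> w) = v \<odot> (u \<odot> w)}" for v
    by (intro closed_Collect_all closed_Collect_eq) (intro jp.continuous_on continuous_intros)+
  have 1: "gen_alg x \<subseteq> {u. \<forall>w. u \<odot> (pow x n \<odot> w) = pow x n \<odot> (u \<odot> w)}" for n
    by (intro gen_alg_least sub cl) (auto simp: pow_commute)
  have "u \<odot> (pow x n \<odot> w) = pow x n \<odot> (u \<odot> w)" for n w
    using 1 assms(1) by auto
  then have "gen_alg x \<subseteq> {v. \<forall>w. v \<odot> (u \<odot> w) = u \<odot> (v \<odot> w)}"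
    by (intro gen_alg_least sub cl) auto
  then show ?thesis using assms(2) by auto
qed

text \<open>With \<open>v\<close> the square of \<open>a\<close> and \<open>e - v\<close> the square
  of \<open>b\<close> in \<open>gen_alg a\<close>, multiplications from \<open>gen_alg a\<close>
  commute, and the square of \<open>a \<odot> b\<close> is \<open>v \<odot> (e - v)\<close>.\<close>

lemma minus_square_in_P:
  assumes "v \<in> P" "e - v \<in> P" shows "v - v \<odot> v \<in> P"
proof -
  obtain a where a: "v = a \<odot> a" using assms(1) by (rule P_cases)
  have "norm v \<le> 1"
    using norm_le_norm_add[OF assms] norm_unit_le by simp
  moreover have aA: "a \<in> gen_alg a" and eA: "e \<in> gen_alg a"
    using pow_in_gen_alg[of a 1] pow_in_gen_alg[of a 0] by auto
  ultimately obtain b where b: "b \<in> gen_alg a" "b \<odot> b = e - v"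
    using square_root_exists[of v "gen_alg a"] closed_gen_alg subspace_gen_alg gen_alg_mult a
    by metis
  have "(a \<odot> b) \<odot> (a \<odot> b) = a \<odot> (b \<odot> (a \<odot> b))"
    by (metis aA b(1) commutative gen_alg_commute gen_alg_mult)
  also have "\<dots> = b \<odot> (b \<odot> (a \<odot> a))"
    by (metis aA b(1) commutative gen_alg_commute)
  also have "\<dots> = (a \<odot> a) \<odot> (b \<odot> b)"
    by (metis aA b(1) commutative gen_alg_commute gen_alg_mult)
  also have "\<dots> = v - v \<odot> v"
    by (simp add: b a[symmetric] jp.diff_right)
  finally show ?thesis by (metis square_in_P)
qed

text \<open>With \<open>v = (e + x) / 2\<close> one has \<open>x\<^sup>2 + 4 (v - v\<^sup>2) = e\<close>.\<close>

lemma norm_le_1_if_between: assumes "e - x \<in> P" "e + x \<in> P" shows "norm x \<le> 1"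
proof -
  define v where "v = (1/2) *\<^sub>R (e + x)"
  have half: "(1/2) *\<^sub>R w + (1/2) *\<^sub>R w = w" for w :: 'a
    by (simp flip: scaleR_left_distrib)
  have x: "x = v + v - e" unfolding v_def half by simp
  have "e - v = (1/2) *\<^sub>R (e - x)"
    using half[of e] unfolding v_def by (simp add: algebra_simps)
  then have v: "v \<in> P" "e - v \<in> P"
    using assms by (auto simp: v_def scaleR_in_P)
  have "x \<odot> x + ((v - v \<odot> v) + (v - v \<odot> v) + ((v - v \<odot> v) + (v - v \<odot> v))) = e"
    by (simp add: x distribs algebra_simps)
  moreover have "(v - v \<odot> v) + (v - v \<odot> v) + ((v - v \<odot> v) + (v - v \<odot> v)) \<in> P"
    by (intro add_in_P minus_square_in_P v)
  ultimately have "norm (x \<odot> x) \<le> norm e"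
    using norm_le_norm_add[of "x \<odot> x"] by (metis square_in_P)
  then have "(norm x)\<^sup>2 \<le> 1"
    using norm_unit_le norm_square[of x] by simp
  then show ?thesis by (simp add: power_le_one_iff abs_square_le_1)
qed

section \<open>Projections\<close>

text \<open>
  Put \<open>y = e - p\<close> and \<open>T = 2 L\<^sub>y\<close>. Since \<open>-e \<le> y \<plusminus> k \<le> e\<close> for \<open>-p \<le> k \<le> p\<close>, squaring gives
  \<open>-p \<le> T k \<le> p\<close>. As \<open>T\<close> is annihilated by \<open>t (t - 1) (t - 2)\<close>, boundedness of its orbits kills
  the eigenvalue 2, so \<open>T\<close> is idempotent on the interval \<open>[-p, p]\<close>. An element \<open>v\<close> of
  eigenvalue 1 there has \<open>y v\<^sup>2 = 0\<close>, and the Jordan identity forces \<open>v\<^sup>3 = 0\<close>.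
\<close>

lemma projection_mult_eq:
  assumes p: "p \<odot> p = p" and u: "p - u \<in> P" "p + u \<in> P"
  shows "p \<odot> u = u"
proof -
  define y where "y = e - p"
  have yy: "y \<odot> y = y" by (simp add: y_def distribs p)
  then have yP: "y \<in> P" by (metis square_in_P)
  have pP: "p \<in> P" using p by (metis square_in_P)
  define T where "T w = y \<odot> w + y \<odot> w" for w
  \<comment> \<open>The term \<open>k \<odot> k\<close> is kept because at a fixed point
    \<open>v\<close> of \<open>T\<close> the two bounds add up to positivity of
    \<open>p - v \<odot> v\<close>.\<close>
  have step: "p - T k - k \<odot> k \<in> P" "p + T k - k \<odot> k \<in> P" if "p - k \<in> P" "p + k \<in> P" for k
  proof -
    have "e - (y + k) \<odot> (y + k) \<in> P"
    proof (rule unit_minus_in_P[OF norm_square_le_1[OF norm_le_1_if_between]])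
      show "e - (y + k) \<in> P" using that by (simp add: y_def)
      show "e + (y + k) \<in> P"
        using add_in_P[OF that(2) add_in_P[OF yP yP]] by (simp add: y_def algebra_simps)
    qed
    moreover have "e - (y - k) \<odot> (y - k) \<in> P"
    proof (rule unit_minus_in_P[OF norm_square_le_1[OF norm_le_1_if_between]])
      show "e - (y - k) \<in> P" using that by (simp add: y_def add.commute)
      show "e + (y - k) \<in> P"
        using add_in_P[OF that(1) add_in_P[OF yP yP]] by (simp add: y_def algebra_simps)
    qed
    moreover have "e - (y + k) \<odot> (y + k) = p - T k - k \<odot> k"
      "e - (y - k) \<odot> (y - k) = p + T k - k \<odot> k"
      using commutative[of k y]
      by (simp_all add: T_def distribs yy) (simp_all add: y_def algebra_simps)
    ultimately show "p - T k - k \<odot> k \<in> P" "p + T k - k \<odot> k \<in> P" by simp_all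
  qed
  have step': "p - T k \<in> P" "p + T k \<in> P" if "p - k \<in> P" "p + k \<in> P" for k
    using add_in_P[OF step(1)[OF that] square_in_P[of k]]
      add_in_P[OF step(2)[OF that] square_in_P[of k]] by simp_all
  have norm_le: "norm k \<le> 1" if "p - k \<in> P" "p + k \<in> P" for k
    using add_in_P[OF that(1) yP] add_in_P[OF that(2) yP]
    by (intro norm_le_1_if_between) (simp_all add: y_def algebra_simps)
  have T_add: "T (a + b) = T a + T b" and T_diff: "T (a - b) = T a - T b" for a b
    by (simp_all add: T_def distribs)
  \<comment> \<open>In terms of multiplication \<open>L\<close> by \<open>y\<close> this is
    \<open>2 L^3 + L = 3 L^2\<close>, which is the annihilating polynomial of
    \<open>T = 2 L\<close>.\<close>
  have cubic: "y \<odot> (y \<odot> (y \<odot> w)) + y \<odot> (y \<odot> (y \<odot> w)) + y \<odot> w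
      = y \<odot> (y \<odot> w) + y \<odot> (y \<odot> w) + y \<odot> (y \<odot> w)" for w
    using jordan_linearized[of w y y] by (simp add: yy commutative[of w] commutative[of "y \<odot> w"] algebra_simps)
  have idem: "T (T k) = T k" if k: "p - k \<in> P" "p + k \<in> P" for k
  proof -
    \<comment> \<open>\<open>d\<close> is \<open>T (T - 1) k\<close>, so \<open>T d = d + d\<close>:
      successive differences of the orbit double although the orbit stays in the unit ball.\<close>
    define d where "d = T (T k) - T k"
    define a b c where "a = y \<odot> k" and "b = y \<odot> a" and "c = y \<odot> b"
    have c: "c + c = b + b + b - a"
      using cubic[of k] by (simp add: a_def b_def c_def algebra_simps)
    have "T k = a + a" "T (T k) = (b + b) + (b + b)"
      by (simp_all add: T_def a_def b_def distribs)
    moreover from this have "T (T (T k)) = ((c + c) + (c + c)) + ((c + c) + (c + c))"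
      by (simp add: T_def c_def distribs)
    ultimately have Td: "T d = d + d"
      unfolding d_def T_diff c by simp
    have orbit: "p - (T ^^ n) k \<in> P \<and> p + (T ^^ n) k \<in> P" for n
      by (induction n) (auto simp: k step')
    have diff: "(T ^^ Suc (Suc n)) k - (T ^^ Suc n) k = 2 ^ n *\<^sub>R d" for n
    proof (induction n)
      case 0
      show ?case by (simp add: d_def)
    next
      case (Suc n)
      have "(T ^^ Suc (Suc (Suc n))) k - (T ^^ Suc (Suc n)) k = T (2 ^ n *\<^sub>R d)"
        unfolding Suc[symmetric] T_diff by simp
      also have "\<dots> = 2 ^ n *\<^sub>R T d"
        by (simp add: T_def jp.scaleR_right scaleR_right_distrib)
      finally show ?case by (simp add: Td scaleR_left_distrib flip: scaleR_2)
    qed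
    have bound: "2 ^ n * norm d \<le> 2" for n
    proof -
      have "2 ^ n * norm d = norm ((T ^^ Suc (Suc n)) k - (T ^^ Suc n) k)"
        unfolding diff by simp
      also have "\<dots> \<le> 2"
        using norm_triangle_ineq4[of "(T ^^ Suc (Suc n)) k" "(T ^^ Suc n) k"]
          norm_le[of "(T ^^ Suc (Suc n)) k"] norm_le[of "(T ^^ Suc n) k"]
          orbit[of "Suc (Suc n)"] orbit[of "Suc n"] by linarith
      finally show ?thesis .
    qed
    have "d = 0"
    proof (rule ccontr)
      assume "d \<noteq> 0"
      obtain n where "2 / norm d < 2 ^ n" using real_arch_pow[of 2 "2 / norm d"] by auto
      then show False using bound[of n] \<open>d \<noteq> 0\<close> by (simp add: field_simps)
    qed
    then show ?thesis by (simp add: d_def)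
  qed
  define v where "v = T u"
  have v: "p - v \<in> P" "p + v \<in> P" "T v = v"
    using step' idem u by (simp_all add: v_def)
  define h where "h = y \<odot> v"
  have vh: "v = h + h" using v(3) by (simp add: T_def h_def)
  have hv: "v \<odot> y = h" by (simp add: h_def commutative)
  have yh: "y \<odot> h + y \<odot> h = h" by (metis h_def jp.add_right vh)
  have "2 *\<^sub>R (p - v \<odot> v) \<in> P"
    using add_in_P[OF step[OF v(1,2)]] unfolding v(3) scaleR_2 by (simp add: algebra_simps)
  then have "p - v \<odot> v \<in> P" by (simp add: in_P_scaleR_iff)
  then have Tvv: "T (T (v \<odot> v)) = T (v \<odot> v)"
    using pP by (intro idem add_in_P) simp_all
  have "v \<odot> (y \<odot> h) + v \<odot> (y \<odot> h) = h \<odot> h + h \<odot> h"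
    by (metis jp.add_left jp.add_right vh yh)
  \<comment> \<open>On \<open>v \<odot> v\<close> multiplication \<open>L\<close> by
    \<open>y\<close> now satisfies \<open>L^2 = L\<close>, while idempotence of \<open>T\<close>
    says \<open>2 L^2 = L\<close>; together they give \<open>L = 0\<close> there.\<close>
  then have "y \<odot> (y \<odot> (v \<odot> v)) = y \<odot> (v \<odot> v)"
    using jordan_linearized[of y y v] by (simp add: hv yy)
  with Tvv have "y \<odot> (v \<odot> v) + y \<odot> (v \<odot> v) = 0"
    by (simp add: T_def jp.add_right)
  then have yvv: "y \<odot> (v \<odot> v) = 0"
    by (simp flip: scaleR_2)
  have "h \<odot> (v \<odot> v) = 0"
    using jordan_identity[of v y] by (simp add: hv yvv jp.zero_right)
  then have "v \<odot> (v \<odot> v) = 0"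
    by (subst vh) (simp add: jp.add_left)
  then have "(v \<odot> v) \<odot> (v \<odot> v) = 0"
    using jordan_identity[of v v] by (simp add: jp.zero_right)
  then have "v = 0"
    using norm_square[of "v \<odot> v"] norm_square[of v] by simp
  then have "2 *\<^sub>R (y \<odot> u) = 0" unfolding scaleR_2 by (simp add: v_def T_def)
  then show ?thesis by (simp add: y_def jp.diff_left)
qed

section \<open>Peirce components and central projections\<close>

text \<open>All three rules come from the instance \<open>J\<close> of the linearized identity.
  Orthogonality uses it in both orders: one gives
  \<open>p \<odot> (b \<odot> c) = b \<odot> c\<close>, the other
  \<open>p \<odot> (b \<odot> c) = 0\<close>.\<close>

lemma peirce_rules:
  assumes p: "p \<odot> p = p"
  shows "p \<odot> b = b \<Longrightarrow> p \<odot> c = 0 \<Longrightarrow> b \<odot> c = 0"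
    and "p \<odot> b = b \<Longrightarrow> p \<odot> c = c \<Longrightarrow> p \<odot> (b \<odot> c) = b \<odot> c"
    and "p \<odot> b = 0 \<Longrightarrow> p \<odot> c = 0 \<Longrightarrow> p \<odot> (b \<odot> c) = 0"
proof -
  have J: "c \<odot> (p \<odot> b) + (p \<odot> (b \<odot> (p \<odot> c)) + p \<odot> (b \<odot> (p \<odot> c)))
    = p \<odot> (c \<odot> b) + ((p \<odot> b) \<odot> (p \<odot> c) + (p \<odot> b) \<odot> (p \<odot> c))" for b c
    using jordan_linearized[of c b p] by (simp add: p commutative)
  show "b \<odot> c = 0" if "p \<odot> b = b" "p \<odot> c = 0"
    using J[of c b] J[of b c] that
    by (simp add: jp.zero_left jp.zero_right commutative[of c b])
  show "p \<odot> (b \<odot> c) = b \<odot> c" if "p \<odot> b = b" "p \<odot> c = c"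
    using J[of c b] that by (simp add: commutative[of c b])
  show "p \<odot> (b \<odot> c) = 0" if "p \<odot> b = 0" "p \<odot> c = 0"
    using J[of c b] that by (simp add: jp.zero_left jp.zero_right commutative[of c b])
qed

definition central_projections :: "'a set" where
  "central_projections = {z. projection (\<odot>) z \<and> central (\<odot>) z}"

text \<open>Idempotent multiplication leaves only the eigenvalues 0 and 1, and on those components
  the Peirce rules determine all products.\<close>

lemma central_projectionI:
  assumes p: "p \<odot> p = p" and idem: "\<And>w. p \<odot> (p \<odot> w) = p \<odot> w"
  shows "p \<in> central_projections"
proof -
  have "p \<odot> (u \<odot> w) = u \<odot> (p \<odot> w)" for u w
  proof -
    define u1 u0 w1 w0 where "u1 = p \<odot> u" and "u0 = u - p \<odot> u" and "w1 = p \<odot> w" and "w0 = w - p \<odot> w"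
    have eigen: "p \<odot> u1 = u1" "p \<odot> u0 = 0" "p \<odot> w1 = w1" "p \<odot> w0 = 0"
      by (simp_all add: u1_def u0_def w1_def w0_def idem jp.diff_right)
    have "u = u1 + u0" "w = w1 + w0"
      by (simp_all add: u1_def u0_def w1_def w0_def)
    then show ?thesis
      using eigen peirce_rules[OF p] commutative[of u0 w1]
      by (simp add: distribs jp.zero_right)
  qed
  then show ?thesis
    using p by (simp add: central_projections_def projection_def central_def operator_commute_def)
qed

lemma central_projectionD:
  assumes "z \<in> central_projections"
  shows "z \<odot> z = z" "z \<odot> (x \<odot> y) = x \<odot> (z \<odot> y)" "z \<odot> (z \<odot> x) = z \<odot> x"
    "z \<odot> x \<odot> y = z \<odot> (x \<odot> y)"
proof -
  show zz: "z \<odot> z = z" and c: "z \<odot> (x \<odot> y) = x \<odot> (z \<odot> y)" for x y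
    using assms
    by (auto simp: central_projections_def projection_def central_def operator_commute_def)
  show "z \<odot> (z \<odot> x) = z \<odot> x"
    using c[of x z] zz by (metis commutative)
  show "z \<odot> x \<odot> y = z \<odot> (x \<odot> y)"
    using c[of y x] by (metis commutative)
qed

lemma central_projection_complement:
  assumes "z \<in> central_projections" shows "e - z \<in> central_projections"
  using central_projectionD(1,3)[OF assms]
  by (intro central_projectionI) (simp_all add: distribs)

lemma unit_minus_mult: "(e - z) \<odot> x = x - z \<odot> x"
  by (simp add: jp.diff_left)

lemma central_projection_mult_in_P:
  assumes "z \<in> central_projections" "u \<in> P" shows "z \<odot> u \<in> P"
proof -
  obtain a where "u = a \<odot> a" using assms(2) by (rule P_cases)
  then have "z \<odot> u = (z \<odot> a) \<odot> (z \<odot> a)"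
    using central_projectionD[OF assms(1)] by metis
  then show ?thesis by simp
qed

lemma le_iff_central:
  assumes "z \<in> central_projections"
  shows "x \<preceq> y \<longleftrightarrow> z \<odot> x \<preceq> z \<odot> y \<and> (e - z) \<odot> x \<preceq> (e - z) \<odot> y"
proof
  assume "x \<preceq> y"
  then show "z \<odot> x \<preceq> z \<odot> y \<and> (e - z) \<odot> x \<preceq> (e - z) \<odot> y"
    using central_projection_mult_in_P[OF assms, of "y - x"]
      central_projection_mult_in_P[OF central_projection_complement[OF assms], of "y - x"]
    by (simp add: le_iff jp.diff_right)
next
  assume "z \<odot> x \<preceq> z \<odot> y \<and> (e - z) \<odot> x \<preceq> (e - z) \<odot> y"
  then show "x \<preceq> y"
    using add_in_P[of "z \<odot> y - z \<odot> x" "(e - z) \<odot> y - (e - z) \<odot> x"]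
    by (simp add: le_iff unit_minus_mult)
qed

lemma range_central_iff:
  assumes "z \<in> central_projections" shows "u \<in> range ((\<odot>) z) \<longleftrightarrow> z \<odot> u = u"
proof
  show "z \<odot> u = u" if "u \<in> range ((\<odot>) z)"
    using that central_projectionD(3)[OF assms] by auto
  show "u \<in> range ((\<odot>) z)" if "z \<odot> u = u"
    using rangeI[of "(\<odot>) z" u] that by simp
qed

lemma range_complement_iff:
  assumes "z \<in> central_projections" shows "u \<in> range ((\<odot>) (e - z)) \<longleftrightarrow> z \<odot> u = 0"
  using range_central_iff[OF central_projection_complement[OF assms]]
  by (simp add: unit_minus_mult)

text \<open>Each projection absorbs the other. Comparing only positive parts lets one lemma serve
  both the cone factors and the full ranges.\<close>

lemma range_central_inj:
  assumes "z \<in> central_projections" "z' \<in> central_projections"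
    and "P \<inter> range ((\<odot>) z) = P \<inter> range ((\<odot>) z')"
  shows "z = z'"
proof -
  have P: "z \<in> P" "z' \<in> P"
    using assms(1,2) central_projectionD(1) by (metis square_in_P)+
  have "z \<in> range ((\<odot>) z)" "z' \<in> range ((\<odot>) z')"
    using assms(1,2) by (simp_all add: range_central_iff central_projectionD(1))
  then have "z \<in> range ((\<odot>) z')" "z' \<in> range ((\<odot>) z)"
    using assms(3) P by blast+
  then have "z' \<odot> z = z" "z \<odot> z' = z'"
    using assms(1,2) by (simp_all add: range_central_iff)
  then show ?thesis by (metis commutative)
qed

text \<open>\<open>Q\<close> is left open so that the whole algebra, the cone and the interval
  \<open>[0, e]\<close> are all instances.\<close>

lemma internal_order_product_central:
  assumes z: "z \<in> central_projections" and "0 \<in> Q"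
    and Q: "\<And>u. u \<in> Q \<Longrightarrow> z \<odot> u \<in> Q" "\<And>u. u \<in> Q \<Longrightarrow> (e - z) \<odot> u \<in> Q"
      "\<And>u w. u \<in> Q \<Longrightarrow> w \<in> Q \<Longrightarrow> z \<odot> u + (e - z) \<odot> w \<in> Q"
  shows "internal_order_product le 0 Q (Q \<inter> range ((\<odot>) z)) (Q \<inter> range ((\<odot>) (e - z)))"
proof -
  note z' = central_projection_complement[OF z]
  have zero: "z \<odot> ((e - z) \<odot> u) = 0" "(e - z) \<odot> (z \<odot> u) = 0" for u
    using central_projectionD(3)[OF z] by (simp_all add: unit_minus_mult jp.diff_right)
  define \<phi> where "\<phi> u = (z \<odot> u, (e - z) \<odot> u)" for u
  have "bij_betw \<phi> Q ((Q \<inter> range ((\<odot>) z)) \<times> (Q \<inter> range ((\<odot>) (e - z))))"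
    unfolding bij_betw_def
  proof
    show "inj_on \<phi> Q"
      by (rule inj_onI) (auto simp: \<phi>_def unit_minus_mult)
    show "\<phi> ` Q = (Q \<inter> range ((\<odot>) z)) \<times> (Q \<inter> range ((\<odot>) (e - z)))"
    proof safe
      fix x y assume xy: "z \<odot> x \<in> Q" "(e - z) \<odot> y \<in> Q"
      have "z \<odot> x + (e - z) \<odot> y \<in> Q"
        using Q(3)[OF xy] central_projectionD(3)[OF z] central_projectionD(3)[OF z'] by simp
      moreover have "\<phi> (z \<odot> x + (e - z) \<odot> y) = (z \<odot> x, (e - z) \<odot> y)"
        by (simp add: \<phi>_def jp.add_right zero central_projectionD(3)[OF z] central_projectionD(3)[OF z'])
      ultimately show "(z \<odot> x, (e - z) \<odot> y) \<in> \<phi> ` Q" by (metis imageI)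
    qed (auto simp: \<phi>_def Q)
  qed
  moreover have "\<phi> u = (u, 0)" if "u \<in> range ((\<odot>) z)" for u
    using that by (auto simp: \<phi>_def zero central_projectionD(3)[OF z])
  moreover have "\<phi> u = (0, u)" if "u \<in> range ((\<odot>) (e - z))" for u
    using that by (auto simp: \<phi>_def zero central_projectionD(3)[OF z'])
  moreover have "u \<preceq> w \<longleftrightarrow> fst (\<phi> u) \<preceq> fst (\<phi> w) \<and> snd (\<phi> u) \<preceq> snd (\<phi> w)" for u w
    unfolding \<phi>_def fst_conv snd_conv by (rule le_iff_central[OF z])
  moreover have "0 \<in> range ((\<odot>) a)" for a
    using rangeI[of "(\<odot>) a" 0] by (simp add: jp.zero_right)
  ultimately show ?thesis
    unfolding internal_order_product_def using \<open>0 \<in> Q\<close> by blast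
qed

end

context unital_jb_algebra
begin

section \<open>Order decompositions\<close>

lemma mem_order_interval: "u \<in> order_interval (\<odot>) 0 x \<longleftrightarrow> u \<in> P \<and> x - u \<in> P"
  by (simp add: order_interval_def jb_le_def)

lemma projection_mult_eq_of_le:
  assumes "p \<odot> p = p" "u \<in> P" "p - u \<in> P" shows "p \<odot> u = u"
proof -
  have "p + u \<in> P" using assms(2) square_in_P[of p] unfolding assms(1) by (simp add: add_in_P)
  then show ?thesis by (rule projection_mult_eq[OF assms(1,3)])
qed

end

text \<open>A common frame for the interval \<open>[0, e]\<close> and the cone: \<open>Q\<close> is
  a hereditary part of the cone containing \<open>e\<close>, and the isomorphism is named so that it
  can be rescaled and translated.\<close>

locale order_decomposition = unital_jb_algebra jp e
  for jp :: "'a::banach \<Rightarrow> 'a \<Rightarrow> 'a"  (infixl "\<odot>" 70) and e +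
  fixes Q A B :: "'a set" and \<phi> :: "'a \<Rightarrow> 'a \<times> 'a"
  assumes Q_P: "Q \<subseteq> P"
    and Q_down: "\<And>u v. u \<in> P \<Longrightarrow> u \<preceq> v \<Longrightarrow> v \<in> Q \<Longrightarrow> u \<in> Q"
    and e_Q: "e \<in> Q"
    and A_Q: "A \<subseteq> Q" and B_Q: "B \<subseteq> Q" and zero_A: "0 \<in> A" and zero_B: "0 \<in> B"
    and bij: "bij_betw \<phi> Q (A \<times> B)"
    and mono: "\<And>x y. x \<in> Q \<Longrightarrow> y \<in> Q \<Longrightarrow> x \<preceq> y \<longleftrightarrow> fst (\<phi> x) \<preceq> fst (\<phi> y) \<and> snd (\<phi> x) \<preceq> snd (\<phi> y)"
    and \<phi>_A: "\<And>a. a \<in> A \<Longrightarrow> \<phi> a = (a, 0)" and \<phi>_B: "\<And>b. b \<in> B \<Longrightarrow> \<phi> b = (0, b)"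
begin

lemma \<phi>_inj: "x \<in> Q \<Longrightarrow> y \<in> Q \<Longrightarrow> \<phi> x = \<phi> y \<Longrightarrow> x = y"
  using bij_betw_imp_inj_on[OF bij] by (rule inj_onD)

lemma \<phi>_mem: "x \<in> Q \<Longrightarrow> fst (\<phi> x) \<in> A" "x \<in> Q \<Longrightarrow> snd (\<phi> x) \<in> B"
  using bij_betw_apply[OF bij] by (simp_all add: mem_Times_iff)

lemma A_P: "a \<in> A \<Longrightarrow> a \<in> P" and B_P: "b \<in> B \<Longrightarrow> b \<in> P"
  using Q_P A_Q B_Q by auto

lemma zero_le_iff: "0 \<preceq> u \<longleftrightarrow> u \<in> P"
  by (simp add: le_iff)

lemma le_zero: "u \<in> P \<Longrightarrow> u \<preceq> 0 \<Longrightarrow> u = 0"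
  using le_antisym[of u 0] by (simp add: zero_le_iff)

text \<open>The second coordinate of \<open>u\<close> is at most that of \<open>a\<close>, which is
  0, and it is positive as an element of \<open>B\<close>.\<close>

lemma A_down: assumes "u \<in> P" "u \<preceq> a" "a \<in> A" shows "u \<in> A"
proof -
  have uQ: "u \<in> Q" using assms A_Q Q_down by blast
  have "snd (\<phi> u) \<preceq> 0"
    using mono[OF uQ, of a] assms A_Q \<phi>_A by auto
  then have "\<phi> u = \<phi> (fst (\<phi> u))"
    using \<phi>_A[OF \<phi>_mem(1)[OF uQ]] le_zero B_P \<phi>_mem(2)[OF uQ] by (metis prod.collapse)
  then have "u = fst (\<phi> u)"
    using \<phi>_inj[OF uQ] \<phi>_mem(1)[OF uQ] A_Q by auto
  then show ?thesis using \<phi>_mem(1)[OF uQ] by simp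
qed

lemma B_down: assumes "u \<in> P" "u \<preceq> b" "b \<in> B" shows "u \<in> B"
proof -
  have uQ: "u \<in> Q" using assms B_Q Q_down by blast
  have "fst (\<phi> u) \<preceq> 0"
    using mono[OF uQ, of b] assms B_Q \<phi>_B by auto
  then have "\<phi> u = \<phi> (snd (\<phi> u))"
    using \<phi>_B[OF \<phi>_mem(2)[OF uQ]] le_zero A_P \<phi>_mem(1)[OF uQ] by (metis prod.collapse)
  then have "u = snd (\<phi> u)"
    using \<phi>_inj[OF uQ] \<phi>_mem(2)[OF uQ] B_Q by auto
  then show ?thesis using \<phi>_mem(2)[OF uQ] by simp
qed

lemma A_B_disjoint: "u \<in> A \<Longrightarrow> u \<in> B \<Longrightarrow> u = 0"
  using \<phi>_A[of u] \<phi>_B[of u] by simp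

text \<open>
  The join \<open>s\<close> of \<open>a\<close> and \<open>b\<close> lies below \<open>a + b\<close>, and the reflected element \<open>a + b - s\<close> is a
  positive lower bound of both, hence zero.
\<close>

lemma \<phi>_sum:
  assumes a: "a \<in> A" and b: "b \<in> B" and ab: "a + b \<in> Q"
  shows "\<phi> (a + b) = (a, b)"
proof -
  have "(a, b) \<in> \<phi> ` Q" using bij a b by (simp add: bij_betw_def)
  then obtain s where s: "s \<in> Q" "\<phi> s = (a, b)" by auto
  have aQ: "a \<in> Q" and bQ: "b \<in> Q" using a b A_Q B_Q by auto
  have "a \<preceq> a + b" "b \<preceq> a + b" using a b A_P B_P by (auto simp: le_iff)
  then have "a \<preceq> fst (\<phi> (a + b))" "b \<preceq> snd (\<phi> (a + b))"
    using mono[OF aQ ab] mono[OF bQ ab] \<phi>_A[OF a] \<phi>_B[OF b] by auto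
  then have i_P: "a + b - s \<in> P"
    using mono[OF s(1) ab] s(2) by (simp add: le_iff)
  have "a \<preceq> s" "b \<preceq> s"
    using mono[OF aQ s(1)] mono[OF bQ s(1)] \<phi>_A[OF a] \<phi>_B[OF b] s(2) A_P[OF a] B_P[OF b]
    by (auto simp: zero_le_iff)
  then have "a + b - s \<preceq> b" "a + b - s \<preceq> a"
    by (simp_all add: le_iff algebra_simps)
  then have "a + b - s = 0"
    using A_B_disjoint A_down[OF i_P _ a] B_down[OF i_P _ b] by blast
  then show ?thesis using s(2) by simp
qed

text \<open>\<open>\<phi>_sum\<close> needs the sum to lie in \<open>Q\<close>, but
  \<open>x + y \<preceq> e\<close> is not known in advance. Halving helps: the half sum is below
  \<open>e\<close> anyway, its coordinates are the halves of \<open>x\<close> and \<open>y\<close>,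
  and both halves lie below half of \<open>e\<close>. Monotonicity then yields the missing
  bound.\<close>

lemma unit_splits:
  obtains x where "x \<in> A" "e - x \<in> B" "x \<odot> x = x" "\<phi> e = (x, e - x)"
proof -
  define x y where "x = fst (\<phi> e)" and "y = snd (\<phi> e)"
  have xA: "x \<in> A" and yB: "y \<in> B" and \<phi>e: "\<phi> e = (x, y)"
    using \<phi>_mem[OF e_Q] by (simp_all add: x_def y_def)
  have xQ: "x \<in> Q" and yQ: "y \<in> Q" using xA yB A_Q B_Q by auto
  have xP: "x \<in> P" and yP: "y \<in> P" using xA yB A_P B_P by auto
  have xe: "x \<preceq> e" and ye: "y \<preceq> e"
    using mono[OF xQ e_Q] mono[OF yQ e_Q] \<phi>e \<phi>_A[OF xA] \<phi>_B[OF yB] xP yP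
    by (auto simp: zero_le_iff)
  have half: "w - (1/2) *\<^sub>R w = (1/2) *\<^sub>R w" for w :: 'a
    by (metis add_diff_cancel_left' scaleR_half_double scaleR_right_distrib)
  have half_mem: "(1/2) *\<^sub>R x \<in> A" "(1/2) *\<^sub>R y \<in> B" "(1/2) *\<^sub>R e \<in> Q"
    by (auto intro!: A_down[OF _ _ xA] B_down[OF _ _ yB] Q_down[OF _ _ e_Q] scaleR_in_P xP yP
        simp: le_iff half)
  have "(1/2) *\<^sub>R (e - x) + (1/2) *\<^sub>R (e - y) \<in> P"
    using xe ye by (auto simp: le_iff intro!: add_in_P scaleR_in_P)
  then have "e - ((1/2) *\<^sub>R x + (1/2) *\<^sub>R y) \<in> P"
    using half[of e] by (simp add: algebra_simps)
  then have mem: "(1/2) *\<^sub>R x + (1/2) *\<^sub>R y \<in> Q"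
    using xP yP by (intro Q_down[OF _ _ e_Q]) (auto simp: le_iff intro!: add_in_P scaleR_in_P)
  have "(1/2) *\<^sub>R x \<preceq> (1/2) *\<^sub>R e" "(1/2) *\<^sub>R y \<preceq> (1/2) *\<^sub>R e"
    using xe ye by (auto simp: le_iff simp flip: scaleR_right_diff_distrib intro!: scaleR_in_P)
  then have "(1/2) *\<^sub>R x + (1/2) *\<^sub>R y \<preceq> (1/2) *\<^sub>R e"
    using mono[OF mem half_mem(3)] \<phi>_sum[OF half_mem(1,2) mem]
      mono[OF _ half_mem(3), of "(1/2) *\<^sub>R x"] mono[OF _ half_mem(3), of "(1/2) *\<^sub>R y"]
      \<phi>_A[OF half_mem(1)] \<phi>_B[OF half_mem(2)] half_mem A_Q B_Q by auto
  then have "(1/2) *\<^sub>R (e - (x + y)) \<in> P"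
    by (simp add: le_iff algebra_simps)
  then have le_e: "e - (x + y) \<in> P"
    by (subst (asm) in_P_scaleR_iff) auto
  then have xyQ: "x + y \<in> Q"
    using xP yP by (intro Q_down[OF _ _ e_Q]) (auto simp: le_iff intro: add_in_P)
  have "\<phi> (x + y) = \<phi> e"
    using \<phi>_sum[OF xA yB xyQ] \<phi>e by simp
  then have "x + y = e" using \<phi>_inj xyQ e_Q by blast
  then have y: "y = e - x" by (simp add: algebra_simps)
  have h: "x - x \<odot> x \<in> P"
    using minus_square_in_P[OF xP] yP y by simp
  \<comment> \<open>For the second bound, \<open>y - (x - x \<odot> x)\<close> is the square of
    \<open>y = e - x\<close>.\<close>
  have "x - x \<odot> x \<preceq> x" "x - x \<odot> x \<preceq> y"
    using square_in_P[of y] by (simp_all add: le_iff y distribs algebra_simps)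
  then have "x - x \<odot> x = 0"
    using A_B_disjoint A_down[OF h _ xA] B_down[OF h _ yB] by blast
  then show ?thesis using that xA yB y \<phi>e by simp
qed

text \<open>The factors are described only below \<open>e\<close>, because the bounds come from
  comparison with \<open>\<phi> e\<close>.\<close>

lemma central_splitting:
  obtains z where "z \<in> central_projections" "z \<in> A" "e - z \<in> B"
    "\<And>u. u \<preceq> e \<Longrightarrow> u \<in> A \<longleftrightarrow> u \<in> P \<and> z \<odot> u = u"
    "\<And>u. u \<preceq> e \<Longrightarrow> u \<in> B \<longleftrightarrow> u \<in> P \<and> z \<odot> u = 0"
    "\<phi> e = (z, e - z)"
proof -
  obtain z where z: "z \<in> A" "e - z \<in> B" "z \<odot> z = z" "\<phi> e = (z, e - z)"
    by (rule unit_splits)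
  have y: "(e - z) \<odot> (e - z) = e - z" by (simp add: distribs z)
  have absorb: "q \<odot> u = u" if "q \<odot> q = q" "u \<in> P" "u \<preceq> q" for q u
    using that by (simp add: projection_mult_eq_of_le le_iff)
  have A_le: "a \<preceq> z" if "a \<in> A" "a \<preceq> e" for a
    using mono[of a e] that A_Q e_Q \<phi>_A z(4) by auto
  have B_le: "b \<preceq> e - z" if "b \<in> B" "b \<preceq> e" for b
    using mono[of b e] that B_Q e_Q \<phi>_B z(4) by auto
  have split: "z \<odot> (z \<odot> u) = z \<odot> u" if u: "u \<in> P" "u \<preceq> e" for u
  proof -
    have uQ: "u \<in> Q" using u Q_down e_Q by blast
    define a b where "a = fst (\<phi> u)" and "b = snd (\<phi> u)"
    have ab: "a \<in> A" "b \<in> B" using \<phi>_mem uQ by (auto simp: a_def b_def)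
    have le: "a \<preceq> z" "b \<preceq> e - z"
      using mono[OF uQ e_Q] u(2) z(4) by (auto simp: a_def b_def)
    then have "e - (a + b) \<in> P"
      using add_in_P[of "z - a" "e - z - b"] by (simp add: le_iff algebra_simps)
    then have "a + b \<in> Q"
      using ab A_P B_P e_Q by (intro Q_down[of "a + b" e]) (auto simp: le_iff intro: add_in_P)
    then have "u = a + b"
      using \<phi>_sum[OF ab] \<phi>_inj[OF uQ] by (simp add: a_def b_def)
    moreover have "z \<odot> a = a" "z \<odot> b = 0"
      using absorb[OF z(3) _ le(1)] absorb[OF y _ le(2)] ab A_P B_P by (auto simp: unit_minus_mult)
    ultimately show ?thesis by (simp add: jp.add_right)
  qed
  have "z \<odot> (z \<odot> w) = z \<odot> w" for w
  proof -
    \<comment> \<open>\<open>c\<close> makes \<open>c *\<^sub>R w\<close> of norm at most 1/2, so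
      \<open>u\<close> lies in \<open>[0, e]\<close>; the identity holds at \<open>e\<close>, hence
      passes from \<open>u\<close> to \<open>w\<close>.\<close>
    define c where "c = inverse (2 * (norm w + 1))"
    have c: "c > 0" by (simp add: c_def add_nonneg_pos)
    define u where "u = (1/2) *\<^sub>R e + c *\<^sub>R w"
    have n: "norm (c *\<^sub>R w) \<le> 1/2"
    proof -
      have "0 < 2 + norm w * 2" by (simp add: add_pos_nonneg)
      then show ?thesis by (simp add: c_def field_simps)
    qed
    have "u \<in> P"
      using le_norm_unit[of "- (c *\<^sub>R w)" "1/2"] n by (simp add: u_def le_iff)
    moreover have "e - u = (1/2) *\<^sub>R e - c *\<^sub>R w"
      using scaleR_left_distrib[of "1/2" "1/2" e] by (simp add: u_def algebra_simps)
    then have "u \<preceq> e"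
      using le_norm_unit[OF n] by (simp add: le_iff)
    ultimately
    have "z \<odot> (z \<odot> u) = z \<odot> u" by (rule split)
    then have "c *\<^sub>R (z \<odot> (z \<odot> w)) = c *\<^sub>R (z \<odot> w)"
      by (simp add: u_def jp.add_right jp.scaleR_right z)
    then show ?thesis using c by simp
  qed
  then have central: "z \<in> central_projections"
    using z(3) by (intro central_projectionI)
  have A_iff: "u \<in> A \<longleftrightarrow> u \<in> P \<and> z \<odot> u = u" if "u \<preceq> e" for u
  proof safe
    assume "u \<in> A"
    then show "u \<in> P" "z \<odot> u = u" using A_P A_le absorb z(3) that by auto
  next
    assume u: "u \<in> P" "z \<odot> u = u"
    have "z \<odot> (e - u) \<in> P"
      using that by (intro central_projection_mult_in_P central) (simp add: le_iff)
    then have "u \<preceq> z" using u by (simp add: le_iff jp.diff_right)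
    then show "u \<in> A" using A_down u z(1) by blast
  qed
  have B_iff: "u \<in> B \<longleftrightarrow> u \<in> P \<and> z \<odot> u = 0" if "u \<preceq> e" for u
  proof safe
    assume "u \<in> B"
    then have "u \<in> P" "(e - z) \<odot> u = u" using B_P B_le absorb y that by auto
    then show "u \<in> P" "z \<odot> u = 0" by (simp_all add: unit_minus_mult)
  next
    assume u: "u \<in> P" "z \<odot> u = 0"
    have "(e - z) \<odot> (e - u) \<in> P"
      using that by (intro central_projection_mult_in_P central_projection_complement central) (simp add: le_iff)
    then have "u \<preceq> e - z" using u by (simp add: le_iff jp.diff_right jp.diff_left)
    then show "u \<in> B" using B_down u z(2) by blast
  qed
  show ?thesis using that central z A_iff B_iff by blast
qed

end

context unital_jb_algebra
begin

lemma order_decomposition_if_product: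
  assumes "internal_order_product le 0 Q A B" "Q \<subseteq> P" "e \<in> Q"
    and "\<And>u v. u \<in> P \<Longrightarrow> u \<preceq> v \<Longrightarrow> v \<in> Q \<Longrightarrow> u \<in> Q"
  obtains \<phi> where "order_decomposition (\<odot>) e Q A B \<phi>"
proof -
  from assms(1) obtain \<phi> where \<phi>: "A \<subseteq> Q" "B \<subseteq> Q" "0 \<in> A" "0 \<in> B" "bij_betw \<phi> Q (A \<times> B)"
    "\<forall>x\<in>Q. \<forall>y\<in>Q. x \<preceq> y \<longleftrightarrow> fst (\<phi> x) \<preceq> fst (\<phi> y) \<and> snd (\<phi> x) \<preceq> snd (\<phi> y)"
    "\<forall>a\<in>A. \<phi> a = (a, 0)" "\<forall>b\<in>B. \<phi> b = (0, b)"
    unfolding internal_order_product_def by (elim conjE exE)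
  have "order_decomposition (\<odot>) e Q A B \<phi>"
  proof (intro order_decomposition.intro order_decomposition_axioms.intro unital_jb_algebra_axioms)
    show "u \<in> Q" if "u \<in> P" "u \<preceq> v" "v \<in> Q" for u v
      using assms(4) that by blast
  qed (use assms(2,3) \<phi> in blast)+
  then show ?thesis by (rule that)
qed

lemma central_interval_product:
  assumes z: "z \<in> central_projections"
  shows "internal_order_product le 0 (order_interval (\<odot>) 0 e)
    (order_interval (\<odot>) 0 z) (order_interval (\<odot>) 0 (e - z))"
proof -
  let ?Q = "order_interval (\<odot>) 0 e"
  have sub: "order_interval (\<odot>) 0 z = ?Q \<inter> range ((\<odot>) z)" if z: "z \<in> central_projections" for z
  proof -
    have zz: "z \<odot> z = z" by (rule central_projectionD(1)[OF z])
    have zP: "e - z \<in> P"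
      using central_projection_mult_in_P[OF central_projection_complement[OF z], of e] by simp
    show ?thesis
    proof safe
      fix u assume u: "u \<in> order_interval (\<odot>) 0 z"
      then have "z \<odot> u = u"
        by (simp add: projection_mult_eq_of_le zz mem_order_interval)
      then show "u \<in> range ((\<odot>) z)" using z by (simp add: range_central_iff)
      show "u \<in> ?Q"
        using u add_in_P[of "z - u" "e - z"] zP by (simp add: mem_order_interval)
    next
      fix w assume u: "z \<odot> w \<in> ?Q"
      then show "z \<odot> w \<in> order_interval (\<odot>) 0 z"
        using central_projection_mult_in_P[OF z, of "e - z \<odot> w"] central_projectionD(3)[OF z]
        by (simp add: mem_order_interval jp.diff_right)
    qed
  qed
  note z' = central_projection_complement[OF z]
  have mem: "z \<odot> u + (e - z) \<odot> w \<in> ?Q" if "u \<in> ?Q" "w \<in> ?Q" for u w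
  proof -
    have "z \<odot> u + (e - z) \<odot> w \<in> P" "z \<odot> (e - u) + (e - z) \<odot> (e - w) \<in> P"
      using that z z' by (auto simp: mem_order_interval intro!: add_in_P central_projection_mult_in_P)
    then show ?thesis by (simp add: mem_order_interval distribs algebra_simps)
  qed
  have zero: "0 \<in> ?Q" by (simp add: mem_order_interval)
  show ?thesis
    unfolding sub[OF z] sub[OF z']
    using mem[OF _ zero] mem[OF zero] mem zero
    by (intro internal_order_product_central z) (auto simp: jp.zero_right)
qed

lemma central_decomps_eq: "central_decomps (\<odot>) e = central_projections"
  using central_interval_product by (auto simp: central_decomps_def central_projections_def)

lemma interval_decomps_eq: "interval_decomps (\<odot>) e = (\<lambda>z. (z, e - z)) ` central_projections"
proof safe
  fix x y assume "(x, y) \<in> interval_decomps (\<odot>) e"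
  then have prod: "internal_order_product le 0 (order_interval (\<odot>) 0 e)
      (order_interval (\<odot>) 0 x) (order_interval (\<odot>) 0 y)"
    by (simp add: interval_decomps_def)
  obtain \<phi> where "order_decomposition (\<odot>) e (order_interval (\<odot>) 0 e)
      (order_interval (\<odot>) 0 x) (order_interval (\<odot>) 0 y) \<phi>"
  proof (rule order_decomposition_if_product[OF prod])
    show "u \<in> order_interval (\<odot>) 0 e" if "u \<in> P" "u \<preceq> v" "v \<in> order_interval (\<odot>) 0 e" for u v
      using that le_trans[of u v e] by (simp add: mem_order_interval le_iff)
  qed (auto simp: mem_order_interval)
  then interpret order_decomposition "(\<odot>)" e "order_interval (\<odot>) 0 e"
      "order_interval (\<odot>) 0 x" "order_interval (\<odot>) 0 y" \<phi> .
  obtain z where z: "z \<in> central_projections" "z \<in> order_interval (\<odot>) 0 x"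
    "e - z \<in> order_interval (\<odot>) 0 y" "\<phi> e = (z, e - z)"
    by (rule central_splitting)
  \<comment> \<open>No sign of \<open>x\<close> or \<open>y\<close> is assumed; that
    \<open>0\<close> lies in both factors makes them positive.\<close>
  have x: "x \<in> order_interval (\<odot>) 0 x" and y: "y \<in> order_interval (\<odot>) 0 y"
    using zero_A zero_B by (simp_all add: mem_order_interval)
  have "x \<preceq> z"
    using mono[OF subsetD[OF A_Q x] e_Q] subsetD[OF A_Q x] \<phi>_A[OF x] z(4)
    by (simp add: mem_order_interval le_iff)
  moreover have "y \<preceq> e - z"
    using mono[OF subsetD[OF B_Q y] e_Q] subsetD[OF B_Q y] \<phi>_B[OF y] z(4)
    by (simp add: mem_order_interval le_iff)
  ultimately have "x = z" "y = e - z"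
    using z(2,3) le_antisym by (auto simp: mem_order_interval le_iff)
  then show "(x, y) \<in> (\<lambda>z. (z, e - z)) ` central_projections" using z(1) by auto
next
  fix z assume "z \<in> central_projections"
  then show "(z, e - z) \<in> interval_decomps (\<odot>) e"
    using central_interval_product by (simp add: interval_decomps_def)
qed

end

section \<open>Rescaling: from the unit interval to the cone\<close>

context order_decomposition
begin

text \<open>Dilation by \<open>c\<close> is an order automorphism of the cone, and conjugating
  \<open>\<phi>\<close> by it again gives a decomposition. This reaches elements that are not below
  \<open>e\<close>.\<close>

lemma scaled_decomposition:
  assumes Q: "Q = P" and c: "c > 0"
  shows "order_decomposition (\<odot>) e P {u. c *\<^sub>R u \<in> A} {u. c *\<^sub>R u \<in> B}
    (\<lambda>u. (inverse c *\<^sub>R fst (\<phi> (c *\<^sub>R u)), inverse c *\<^sub>R snd (\<phi> (c *\<^sub>R u))))"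
    (is "order_decomposition _ _ _ ?A ?B ?\<psi>")
proof (unfold_locales)
  have P_iff: "c *\<^sub>R u \<in> P \<longleftrightarrow> u \<in> P" for u
    using c by (rule in_P_scaleR_iff)
  have le_scale: "d *\<^sub>R u \<preceq> d *\<^sub>R v \<longleftrightarrow> u \<preceq> v" if "d > 0" for d u v
    using that by (simp add: le_iff in_P_scaleR_iff flip: scaleR_right_diff_distrib)
  show "u \<in> P" if "u \<in> P" "u \<preceq> v" "v \<in> P" for u v by (rule that(1))
  show "?A \<subseteq> P" "?B \<subseteq> P" using A_P B_P P_iff by auto
  show "0 \<in> ?A" "0 \<in> ?B" using zero_A zero_B by simp_all
  show "bij_betw ?\<psi> P (?A \<times> ?B)"
    unfolding bij_betw_def
  proof
    show "inj_on ?\<psi> P"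
    proof (rule inj_onI)
      fix u v assume "u \<in> P" "v \<in> P" "?\<psi> u = ?\<psi> v"
      then have "\<phi> (c *\<^sub>R u) = \<phi> (c *\<^sub>R v)"
        using c by (simp add: prod_eq_iff)
      then have "c *\<^sub>R u = c *\<^sub>R v"
        using \<open>u \<in> P\<close> \<open>v \<in> P\<close> by (intro \<phi>_inj) (simp_all add: Q P_iff)
      then show "u = v" using c by simp
    qed
    show "?\<psi> ` P = ?A \<times> ?B"
    proof (rule set_eqI, rule iffI)
      fix w assume "w \<in> ?\<psi> ` P"
      then show "w \<in> ?A \<times> ?B" using \<phi>_mem c by (auto simp: Q P_iff)
    next
      fix w assume "w \<in> ?A \<times> ?B"
      then have "(c *\<^sub>R fst w, c *\<^sub>R snd w) \<in> \<phi> ` Q"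
        using bij by (auto simp: bij_betw_def)
      then obtain s where s: "s \<in> P" "\<phi> s = (c *\<^sub>R fst w, c *\<^sub>R snd w)" by (auto simp: Q)
      have "inverse c *\<^sub>R s \<in> P" using s c by (intro scaleR_in_P) auto
      moreover have "?\<psi> (inverse c *\<^sub>R s) = w" using s c by simp
      ultimately show "w \<in> ?\<psi> ` P" by (intro image_eqI[of _ _ "inverse c *\<^sub>R s"]) simp_all
    qed
  qed
  show "u \<preceq> v \<longleftrightarrow> fst (?\<psi> u) \<preceq> fst (?\<psi> v) \<and> snd (?\<psi> u) \<preceq> snd (?\<psi> v)" if "u \<in> P" "v \<in> P" for u v
    using mono[of "c *\<^sub>R u" "c *\<^sub>R v"] that c by (simp add: Q P_iff le_scale)
  show "?\<psi> u = (u, 0)" if "u \<in> ?A" for u using \<phi>_A that c by simp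
  show "?\<psi> u = (0, u)" if "u \<in> ?B" for u using \<phi>_B that c by simp
qed simp_all

text \<open>For large \<open>c\<close> the element \<open>u / c\<close> lies below \<open>e\<close>,
  where the scaled decomposition is governed by some central projection \<open>q\<close>. Since
  \<open>z / c\<close> and \<open>(e - z) / c\<close> lie below \<open>e\<close> too,
  \<open>q\<close> fixes \<open>z\<close> and kills \<open>e - z\<close>, so \<open>q = z\<close>
  whatever \<open>c\<close> is.\<close>

lemma cone_central_splitting:
  assumes Q: "Q = P"
  obtains z where "z \<in> central_projections"
    "\<And>u. u \<in> A \<longleftrightarrow> u \<in> P \<and> z \<odot> u = u" "\<And>u. u \<in> B \<longleftrightarrow> u \<in> P \<and> z \<odot> u = 0"
    "\<And>u. u \<in> P \<Longrightarrow> \<phi> u = (z \<odot> u, u - z \<odot> u)"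
proof -
  obtain z where z: "z \<in> central_projections" "z \<in> A" "e - z \<in> B"
    by (rule central_splitting)
  have iff: "(u \<in> A \<longleftrightarrow> u \<in> P \<and> z \<odot> u = u) \<and> (u \<in> B \<longleftrightarrow> u \<in> P \<and> z \<odot> u = 0)" for u
  proof -
    define c where "c = norm u + 1"
    have c: "c \<ge> 1" by (simp add: c_def)
    interpret scaled: order_decomposition "(\<odot>)" e P "{u. c *\<^sub>R u \<in> A}" "{u. c *\<^sub>R u \<in> B}"
      "\<lambda>u. (inverse c *\<^sub>R fst (\<phi> (c *\<^sub>R u)), inverse c *\<^sub>R snd (\<phi> (c *\<^sub>R u)))"
      using c by (intro scaled_decomposition Q) simp
    obtain q where q: "q \<in> central_projections"
      "\<And>u. u \<preceq> e \<Longrightarrow> u \<in> {u. c *\<^sub>R u \<in> A} \<longleftrightarrow> u \<in> P \<and> q \<odot> u = u"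
      "\<And>u. u \<preceq> e \<Longrightarrow> u \<in> {u. c *\<^sub>R u \<in> B} \<longleftrightarrow> u \<in> P \<and> q \<odot> u = 0"
      using scaled.central_splitting by blast
    have shrink: "inverse c *\<^sub>R w \<preceq> e" if "w \<in> P" "w \<preceq> e" for w
    proof -
      have "(e - w) + (1 - inverse c) *\<^sub>R w \<in> P"
        using that c by (intro add_in_P scaleR_in_P) (auto simp: le_iff field_simps)
      then show ?thesis by (simp add: le_iff algebra_simps)
    qed
    have "inverse c *\<^sub>R z \<preceq> e" "inverse c *\<^sub>R (e - z) \<preceq> e"
      using shrink[of z] shrink[of "e - z"] A_P[OF z(2)] B_P[OF z(3)] by (simp_all add: le_iff)
    then have "q \<odot> (inverse c *\<^sub>R z) = inverse c *\<^sub>R z" "q \<odot> (inverse c *\<^sub>R (e - z)) = 0"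
      using q(2)[of "inverse c *\<^sub>R z"] q(3)[of "inverse c *\<^sub>R (e - z)"] z c by auto
    then have "q \<odot> z = z" "q \<odot> (e - z) = 0"
      using c by (auto simp: jp.scaleR_right)
    then have "q = z" by (simp add: jp.diff_right)
    moreover have "inverse c *\<^sub>R u \<preceq> e"
    proof -
      have "norm u \<le> c" by (simp add: c_def)
      then have "norm (inverse c *\<^sub>R u) \<le> 1" using c by (simp add: field_simps)
      then show ?thesis using le_norm_unit[of _ 1] by simp
    qed
    ultimately show ?thesis
      using q(2,3)[of "inverse c *\<^sub>R u"] c
      by (auto simp: jp.scaleR_right in_P_scaleR_iff)
  qed
  moreover have "\<phi> u = (z \<odot> u, u - z \<odot> u)" if u: "u \<in> P" for u
  proof -
    have "z \<odot> u \<in> A"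
      using iff central_projection_mult_in_P[OF z(1) u] central_projectionD(3)[OF z(1)] by blast
    moreover have "(e - z) \<odot> u \<in> P"
      by (intro central_projection_mult_in_P central_projection_complement z u)
    then have "u - z \<odot> u \<in> B"
      using iff central_projectionD(3)[OF z(1)] by (simp add: unit_minus_mult jp.diff_right)
    ultimately show ?thesis
      using \<phi>_sum[of "z \<odot> u" "u - z \<odot> u"] u by (simp add: Q)
  qed
  ultimately show ?thesis using that z(1) by blast
qed

end

context unital_jb_algebra
begin

lemma cone_decomps_eq:
  "cone_decomps (\<odot>) = (\<lambda>z. (P \<inter> range ((\<odot>) z), P \<inter> range ((\<odot>) (e - z)))) ` central_projections"
proof (rule set_eqI, rule iffI)
  fix C assume "C \<in> cone_decomps (\<odot>)"
  then have "internal_order_product le 0 P (fst C) (snd C)"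
    by (auto simp: cone_decomps_def)
  then obtain \<phi> where "order_decomposition (\<odot>) e P (fst C) (snd C) \<phi>"
    by (rule order_decomposition_if_product) auto
  then interpret order_decomposition "(\<odot>)" e P "fst C" "snd C" \<phi> .
  obtain z where z: "z \<in> central_projections"
    "\<And>u. u \<in> fst C \<longleftrightarrow> u \<in> P \<and> z \<odot> u = u" "\<And>u. u \<in> snd C \<longleftrightarrow> u \<in> P \<and> z \<odot> u = 0"
    by (rule cone_central_splitting) auto
  have "fst C = P \<inter> range ((\<odot>) z)" "snd C = P \<inter> range ((\<odot>) (e - z))"
    by (intro set_eqI; simp add: z range_central_iff range_complement_iff)+
  then show "C \<in> (\<lambda>z. (P \<inter> range ((\<odot>) z), P \<inter> range ((\<odot>) (e - z)))) ` central_projections"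
    using z(1) by (intro image_eqI[of _ _ z]) (simp_all add: prod_eq_iff)
next
  fix C assume "C \<in> (\<lambda>z. (P \<inter> range ((\<odot>) z), P \<inter> range ((\<odot>) (e - z)))) ` central_projections"
  then obtain z where z: "z \<in> central_projections"
    and C: "C = (P \<inter> range ((\<odot>) z), P \<inter> range ((\<odot>) (e - z)))" by blast
  have "internal_order_product le 0 P (P \<inter> range ((\<odot>) z)) (P \<inter> range ((\<odot>) (e - z)))"
    using z central_projection_complement[OF z]
    by (intro internal_order_product_central) (auto intro: central_projection_mult_in_P add_in_P)
  then show "C \<in> cone_decomps (\<odot>)" by (simp add: C cone_decomps_def)
qed

text \<open>
  An order decomposition of the whole algebra, restricted to the points above \<open>x\<close> and translated
  by \<open>-x\<close>, is a decomposition of the cone. Since any two points have a common lower bound, the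
  resulting central projection does not depend on \<open>x\<close>.
\<close>

lemma order_product_central:
  assumes "internal_order_product le 0 UNIV S T"
  obtains z where "z \<in> central_projections" "S = range ((\<odot>) z)" "T = range ((\<odot>) (e - z))"
proof -
  from assms obtain \<phi> where 0: "0 \<in> S" "0 \<in> T" and bij: "bij_betw \<phi> UNIV (S \<times> T)"
    and mono: "\<And>x y. x \<preceq> y \<longleftrightarrow> fst (\<phi> x) \<preceq> fst (\<phi> y) \<and> snd (\<phi> x) \<preceq> snd (\<phi> y)"
    and \<phi>S: "\<And>s. s \<in> S \<Longrightarrow> \<phi> s = (s, 0)" and \<phi>T: "\<And>t. t \<in> T \<Longrightarrow> \<phi> t = (0, t)"
    unfolding internal_order_product_def by (elim conjE exE) blast
  have inj: "\<phi> x = \<phi> y \<Longrightarrow> x = y" for x y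
    using bij by (auto simp: bij_betw_def inj_on_def)
  have mem: "fst (\<phi> x) \<in> S" "snd (\<phi> x) \<in> T" for x
    using bij_betw_apply[OF bij, of x] by (simp_all add: mem_Times_iff)
  define g where "g = inv \<phi>"
  have \<phi>g: "\<phi> (g (s, t)) = (s, t)" if "s \<in> S" "t \<in> T" for s t
    using bij that unfolding g_def bij_betw_def by (metis SigmaI f_inv_into_f)
  have g\<phi>: "g (\<phi> x) = x" for x
    by (simp add: g_def inv_f_f injI inj)
  have "\<exists>z \<in> central_projections. \<forall>u v. x \<preceq> u \<longrightarrow> x \<preceq> v \<longrightarrow>
      (snd (\<phi> u) = snd (\<phi> v) \<longleftrightarrow> z \<odot> (u - v) = u - v) \<and>
      (fst (\<phi> u) = fst (\<phi> v) \<longleftrightarrow> z \<odot> (u - v) = 0)" for x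
  proof -
    define A where "A = {w \<in> P. snd (\<phi> (x + w)) = snd (\<phi> x)}"
    define B where "B = {w \<in> P. fst (\<phi> (x + w)) = fst (\<phi> x)}"
    \<comment> \<open>Each component of \<open>\<psi>\<close> resets one coordinate of
      \<open>x + w\<close> to that of the base point and translates back by
      \<open>x\<close>.\<close>
    define \<psi> where "\<psi> w = (g (fst (\<phi> (x + w)), snd (\<phi> x)) - x, g (fst (\<phi> x), snd (\<phi> (x + w))) - x)" for w
    have \<phi>\<psi>: "\<phi> (x + fst (\<psi> w)) = (fst (\<phi> (x + w)), snd (\<phi> x))"
      "\<phi> (x + snd (\<psi> w)) = (fst (\<phi> x), snd (\<phi> (x + w)))" for w
      by (simp_all add: \<psi>_def \<phi>g mem)
    have add_le: "x + v \<preceq> x + w \<longleftrightarrow> v \<preceq> w" for v w by (simp add: le_iff)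
    have P_iff: "w \<in> P \<longleftrightarrow> fst (\<phi> x) \<preceq> fst (\<phi> (x + w)) \<and> snd (\<phi> x) \<preceq> snd (\<phi> (x + w))" for w
      using mono[of x "x + w"] by (simp add: le_iff)
    have P\<psi>: "fst (\<psi> w) \<in> A" "snd (\<psi> w) \<in> B" if "w \<in> P" for w
      using that P_iff[of w] P_iff[of "fst (\<psi> w)"] P_iff[of "snd (\<psi> w)"]
      by (simp_all add: A_def B_def \<phi>\<psi>)
    have \<psi>A: "\<psi> w = (w, 0)" if "w \<in> A" for w
      using that g\<phi>[of "x + w"] g\<phi>[of x] by (simp add: A_def \<psi>_def flip: surjective_pairing)
        (metis add_diff_cancel_left' cancel_comm_monoid_add_class.diff_cancel prod.collapse)
    have \<psi>B: "\<psi> w = (0, w)" if "w \<in> B" for w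
      using that g\<phi>[of "x + w"] g\<phi>[of x] by (simp add: B_def \<psi>_def flip: surjective_pairing)
        (metis add_diff_cancel_left' cancel_comm_monoid_add_class.diff_cancel prod.collapse)
    have "order_decomposition (\<odot>) e P A B \<psi>"
    proof (unfold_locales)
      show "u \<in> P" if "u \<in> P" "u \<preceq> v" "v \<in> P" for u v by (rule that(1))
      show "A \<subseteq> P" "B \<subseteq> P" "0 \<in> A" "0 \<in> B" by (auto simp: A_def B_def)
      show "bij_betw \<psi> P (A \<times> B)"
        unfolding bij_betw_def
      proof
        show "inj_on \<psi> P"
        proof (rule inj_onI)
          fix v w assume "\<psi> v = \<psi> w"
          then have "\<phi> (x + v) = \<phi> (x + w)"
            using \<phi>\<psi>[of v] \<phi>\<psi>[of w] by (simp add: prod_eq_iff)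
          then show "v = w" using inj by fastforce
        qed
        show "\<psi> ` P = A \<times> B"
        proof (rule set_eqI, rule iffI)
          fix w assume "w \<in> \<psi> ` P"
          then show "w \<in> A \<times> B" using P\<psi> by (auto simp: mem_Times_iff)
        next
          fix w assume w: "w \<in> A \<times> B"
          define u where "u = g (fst (\<phi> (x + fst w)), snd (\<phi> (x + snd w))) - x"
          have \<phi>u: "\<phi> (x + u) = (fst (\<phi> (x + fst w)), snd (\<phi> (x + snd w)))"
            by (simp add: u_def \<phi>g mem)
          have "u \<in> P"
            using w P_iff[of "fst w"] P_iff[of "snd w"] P_iff[of u]
            by (auto simp: \<phi>u A_def B_def mem_Times_iff)
          moreover have "\<psi> u = w"
            using w \<psi>A[of "fst w"] \<psi>B[of "snd w"] by (auto simp: \<psi>_def \<phi>u mem_Times_iff prod_eq_iff)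
          ultimately show "w \<in> \<psi> ` P" by (intro image_eqI[of _ _ u]) simp_all
        qed
      qed
      show "v \<preceq> w \<longleftrightarrow> fst (\<psi> v) \<preceq> fst (\<psi> w) \<and> snd (\<psi> v) \<preceq> snd (\<psi> w)" for v w
        using mono[of "x + v" "x + w"] mono[of "x + fst (\<psi> v)" "x + fst (\<psi> w)"]
          mono[of "x + snd (\<psi> v)" "x + snd (\<psi> w)"]
        unfolding add_le \<phi>\<psi> by simp
      show "\<psi> w = (w, 0)" if "w \<in> A" for w by (rule \<psi>A[OF that])
      show "\<psi> w = (0, w)" if "w \<in> B" for w by (rule \<psi>B[OF that])
    qed simp_all
    then interpret cone: order_decomposition "(\<odot>)" e P A B \<psi> .
    obtain z where z: "z \<in> central_projections" "\<And>w. w \<in> P \<Longrightarrow> \<psi> w = (z \<odot> w, w - z \<odot> w)"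
      by (rule cone.cone_central_splitting) auto
    have "(snd (\<phi> u) = snd (\<phi> v) \<longleftrightarrow> z \<odot> (u - v) = u - v) \<and>
        (fst (\<phi> u) = fst (\<phi> v) \<longleftrightarrow> z \<odot> (u - v) = 0)" if uv: "x \<preceq> u" "x \<preceq> v" for u v
    proof -
      have \<psi>: "\<psi> (u - x) = (z \<odot> (u - x), u - x - z \<odot> (u - x))"
        "\<psi> (v - x) = (z \<odot> (v - x), v - x - z \<odot> (v - x))"
        using uv z(2) by (simp_all add: le_iff)
      have id: "x + (u - x) = u" "x + (v - x) = v" by simp_all
      have "snd (\<phi> u) = snd (\<phi> v) \<longleftrightarrow> snd (\<psi> (u - x)) = snd (\<psi> (v - x))"
      proof
        show "snd (\<psi> (u - x)) = snd (\<psi> (v - x))" if "snd (\<phi> u) = snd (\<phi> v)"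
          using that unfolding \<psi>_def id by simp
        show "snd (\<phi> u) = snd (\<phi> v)" if "snd (\<psi> (u - x)) = snd (\<psi> (v - x))"
          using \<phi>\<psi>(2)[of "u - x"] \<phi>\<psi>(2)[of "v - x"] unfolding id that by simp
      qed
      moreover have "fst (\<phi> u) = fst (\<phi> v) \<longleftrightarrow> fst (\<psi> (u - x)) = fst (\<psi> (v - x))"
      proof
        show "fst (\<psi> (u - x)) = fst (\<psi> (v - x))" if "fst (\<phi> u) = fst (\<phi> v)"
          using that unfolding \<psi>_def id by simp
        show "fst (\<phi> u) = fst (\<phi> v)" if "fst (\<psi> (u - x)) = fst (\<psi> (v - x))"
          using \<phi>\<psi>(1)[of "u - x"] \<phi>\<psi>(1)[of "v - x"] unfolding id that by simp
      qed
      ultimately show ?thesis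
        unfolding \<psi> by (auto simp: jp.diff_right algebra_simps)
    qed
    then show ?thesis using z(1) by blast
  qed
  then obtain Z where Z: "\<And>x. Z x \<in> central_projections"
    "\<And>x u v. x \<preceq> u \<Longrightarrow> x \<preceq> v \<Longrightarrow> snd (\<phi> u) = snd (\<phi> v) \<longleftrightarrow> Z x \<odot> (u - v) = u - v"
    "\<And>x u v. x \<preceq> u \<Longrightarrow> x \<preceq> v \<Longrightarrow> fst (\<phi> u) = fst (\<phi> v) \<longleftrightarrow> Z x \<odot> (u - v) = 0"
    by metis
  have indep: "Z x = Z y" if "x \<preceq> y" for x y
  proof -
    define q where "q = Z x"
    have q: "q \<odot> q = q" "q \<in> P" "e - q \<in> P"
      using central_projectionD(1)[OF Z(1)] central_projection_mult_in_P[OF Z(1), of e]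
        central_projection_mult_in_P[OF central_projection_complement[OF Z(1)], of e]
      by (simp_all add: q_def)
    \<comment> \<open>The pairs \<open>y\<close>, \<open>y + q\<close> and \<open>y\<close>,
      \<open>y + (e - q)\<close> lie above both base points, so \<open>Z x\<close> and
      \<open>Z y\<close> must judge their differences alike.\<close>
    have y: "y \<preceq> y + q" "y \<preceq> y + (e - q)" using q by (simp_all add: le_iff del: add_diff_eq)
    have "Z y \<odot> q = q"
      using Z(2)[OF y(1) le_refl] Z(2)[OF le_trans[OF that y(1)] that] q by (simp add: q_def)
    moreover have "Z y \<odot> (e - q) = 0"
      using Z(3)[OF y(2) le_refl] Z(3)[OF le_trans[OF that y(2)] that] q
      by (simp add: jp.diff_right flip: q_def)
    ultimately show ?thesis by (simp add: q_def jp.diff_right)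
  qed
  define z where "z = Z 0"
  have \<phi>0: "\<phi> 0 = (0, 0)" using \<phi>S[OF 0(1)] .
  have key: "snd (\<phi> u) = 0 \<longleftrightarrow> z \<odot> u = u" "fst (\<phi> u) = 0 \<longleftrightarrow> z \<odot> u = 0" for u
  proof -
    \<comment> \<open>A common lower bound of \<open>u\<close> and \<open>0\<close>, so that
      \<open>u\<close> can be compared with the origin.\<close>
    define x where "x = - (norm u *\<^sub>R e)"
    have x: "x \<preceq> u" "x \<preceq> 0"
      using le_norm_unit[of "- u" "norm u"] scaleR_in_P[of "norm u" e]
      by (simp_all add: x_def le_iff add.commute)
    show "snd (\<phi> u) = 0 \<longleftrightarrow> z \<odot> u = u" "fst (\<phi> u) = 0 \<longleftrightarrow> z \<odot> u = 0"
      using Z(2)[OF x] Z(3)[OF x] indep[OF x(2)] by (simp_all add: \<phi>0 z_def)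
  qed
  have S: "u \<in> S \<longleftrightarrow> snd (\<phi> u) = 0" for u
    using \<phi>S mem(1)[of u] inj by (metis prod.collapse snd_conv)
  have T: "u \<in> T \<longleftrightarrow> fst (\<phi> u) = 0" for u
    using \<phi>T mem(2)[of u] inj by (metis prod.collapse fst_conv)
  have z: "z \<in> central_projections" by (simp add: z_def Z(1))
  show ?thesis
    using that[OF z] by (simp add: set_eq_iff S T key range_central_iff[OF z] range_complement_iff[OF z])
qed

lemma order_decomps_eq:
  "order_decomps (\<odot>) = (\<lambda>z. (range ((\<odot>) z), range ((\<odot>) (e - z)))) ` central_projections"
proof (rule set_eqI, rule iffI)
  fix C assume "C \<in> order_decomps (\<odot>)"
  then have "internal_order_product le 0 UNIV (fst C) (snd C)" by (auto simp: order_decomps_def)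
  then obtain z where "z \<in> central_projections" "fst C = range ((\<odot>) z)" "snd C = range ((\<odot>) (e - z))"
    by (rule order_product_central)
  then show "C \<in> (\<lambda>z. (range ((\<odot>) z), range ((\<odot>) (e - z)))) ` central_projections"
    by (intro image_eqI[of _ _ z]) (simp_all add: prod_eq_iff)
next
  fix C assume "C \<in> (\<lambda>z. (range ((\<odot>) z), range ((\<odot>) (e - z)))) ` central_projections"
  then show "C \<in> order_decomps (\<odot>)"
    using internal_order_product_central[of _ UNIV] by (auto simp: order_decomps_def)
qed

section \<open>Direct sums and weak*-closed summands\<close>

text \<open>The first component \<open>z\<close> of \<open>e\<close> acts as identity on
  \<open>M1\<close>, by multiplying with \<open>e\<close> itself, and as zero on
  \<open>M2\<close>.\<close>

lemma algebra_direct_sum_central: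
  assumes zero: "0 \<in> M1" "0 \<in> M2"
    and sum: "\<And>x. \<exists>!(a, b). a \<in> M1 \<and> b \<in> M2 \<and> x = a + b"
    and mult: "\<And>a b a' b'. a \<in> M1 \<Longrightarrow> b \<in> M2 \<Longrightarrow> a' \<in> M1 \<Longrightarrow> b' \<in> M2 \<Longrightarrow>
      (a + b) \<odot> (a' + b') = a \<odot> a' + b \<odot> b'"
  obtains z where "z \<in> central_projections" "M1 = range ((\<odot>) z)" "M2 = range ((\<odot>) (e - z))"
proof -
  have ex: "\<exists>a\<in>M1. \<exists>b\<in>M2. x = a + b" for x
    using sum[of x] by auto
  obtain z y where zy: "z \<in> M1" "y \<in> M2" "e = z + y" using ex by blast
  have M1: "z \<odot> a = a" if "a \<in> M1" for a
    using mult[OF zy(1,2) that zero(2)] by (simp add: jp.zero_right flip: zy(3))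
  have M2: "z \<odot> b = 0" if "b \<in> M2" for b
    using mult[OF zy(1) zero(2) zero(1) that] by (simp add: jp.zero_left jp.zero_right)
  have z: "z \<in> central_projections"
  proof (rule central_projectionI)
    show "z \<odot> z = z" using M1 zy by simp
    show "z \<odot> (z \<odot> w) = z \<odot> w" for w
    proof -
      obtain a b where "a \<in> M1" "b \<in> M2" "w = a + b" using ex by blast
      then show ?thesis by (simp add: jp.add_right M1 M2)
    qed
  qed
  have "u \<in> M1 \<longleftrightarrow> z \<odot> u = u" "u \<in> M2 \<longleftrightarrow> z \<odot> u = 0" for u
  proof -
    obtain a b where u: "a \<in> M1" "b \<in> M2" "u = a + b" using ex by blast
    then have "z \<odot> u = a" by (simp add: jp.add_right M1 M2)
    then show "u \<in> M1 \<longleftrightarrow> z \<odot> u = u" "u \<in> M2 \<longleftrightarrow> z \<odot> u = 0"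
      using u M1 M2 by auto
  qed
  then show ?thesis
    using that[OF z] by (simp add: set_eq_iff range_central_iff[OF z] range_complement_iff[OF z])
qed

text \<open>The unit ball is the order interval between \<open>- e\<close> and \<open>e\<close>, and
  such bounds may be checked separately on the two central parts; \<open>s\<close> ranges over both
  signs of \<open>1 / m\<close>.\<close>

lemma norm_central_sum_le:
  assumes z: "z \<in> central_projections"
    and a: "z \<odot> a = a" "norm a \<le> m" and b: "z \<odot> b = 0" "norm b \<le> m"
  shows "norm (a + b) \<le> m"
proof (cases "m = 0")
  case True
  then show ?thesis using a b by simp
next
  case False
  then have m: "m > 0" using a(2) norm_ge_zero[of a] by linarith
  define c where "c = inverse m"
  have c: "c > 0" using m by (simp add: c_def)
  have key: "e - s *\<^sub>R (a + b) \<in> P" if s: "\<bar>s\<bar> = c" for s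
  proof -
    have "norm (s *\<^sub>R w) \<le> 1" if "norm w \<le> m" for w
      using that m by (simp add: s c_def field_simps)
    then have "e - s *\<^sub>R a \<in> P" "e - s *\<^sub>R b \<in> P"
      using a(2) b(2) by (auto intro!: unit_minus_in_P simp del: norm_scaleR)
    then have "z \<odot> (e - s *\<^sub>R a) + (e - z) \<odot> (e - s *\<^sub>R b) \<in> P"
      by (intro add_in_P central_projection_mult_in_P central_projection_complement z)
    then show ?thesis
      by (simp add: jp.diff_right jp.scaleR_right unit_minus_mult a b algebra_simps)
  qed
  have "norm (c *\<^sub>R (a + b)) \<le> 1"
    using key[of c] key[of "- c"] c by (intro norm_le_1_if_between) simp_all
  then have "c * norm (a + b) \<le> 1" using c by (simp only: norm_scaleR abs_of_pos)
  then show ?thesis using m by (simp add: c_def field_simps)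
qed

lemma norm_central_mult_le:
  assumes "z \<in> central_projections" shows "norm (z \<odot> x) \<le> norm x"
proof -
  have "e - z \<in> P" "z \<in> P"
    using central_projection_mult_in_P[OF central_projection_complement[OF assms], of e]
      central_projection_mult_in_P[OF assms, of e] by simp_all
  then have "norm z \<le> 1"
    using norm_le_norm_add[of z "e - z"] norm_unit_le by simp
  then show ?thesis
    using norm_prod_le[of z x] mult_right_mono[of "norm z" 1 "norm x"] by simp
qed

text \<open>Multiplication by \<open>z\<close>, transported to the dual by \<open>\<Phi>\<close>, is
  an M-projection by the two preceding norm estimates.\<close>

lemma closedin_range_central:
  fixes \<Phi> :: "'a \<Rightarrow> ('p::banach \<Rightarrow>\<^sub>L real)"
  assumes jbw: "jbw_algebra (\<odot>) \<Phi>" and z: "z \<in> central_projections"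
  shows "closedin strong_operator_topology (\<Phi> ` range ((\<odot>) z))"
proof -
  interpret jbw_algebra "(\<odot>)" \<Phi> by (rule jbw)
  have inj: "inj \<Phi>"
  proof (rule injI)
    fix x y assume "\<Phi> x = \<Phi> y"
    then have "norm (\<Phi> (x - y)) = 0" by (simp add: linear_diff[OF dual_linear])
    then show "x = y" by (simp add: dual_isometric)
  qed
  define R where "R g = \<Phi> (z \<odot> inv \<Phi> g)" for g
  have R: "R (\<Phi> x) = \<Phi> (z \<odot> x)" for x
    by (simp add: R_def inj)
  have ex: "\<exists>x. g = \<Phi> x" for g using dual_surj by (auto simp: surj_def)
  have "m_projection R"
  proof (rule m_projection.intro)
    show "linear R"
    proof (rule linearI)
      fix g h :: "'p \<Rightarrow>\<^sub>L real" and c :: real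
      obtain x y where xy: "g = \<Phi> x" "h = \<Phi> y" using ex by blast
      show "R (g + h) = R g + R h"
        unfolding xy linear_add[OF dual_linear, symmetric] R by (simp add: jp.add_right)
      show "R (c *\<^sub>R g) = c *\<^sub>R R g"
        unfolding xy linear_cmul[OF dual_linear, symmetric] R by (simp add: jp.scaleR_right)
    qed
    fix g
    obtain x where x: "g = \<Phi> x" using ex by blast
    show "R (R g) = R g"
      unfolding x R by (simp add: central_projectionD(3)[OF z])
    have "norm x \<le> max (norm (z \<odot> x)) (norm (x - z \<odot> x))"
      using norm_central_sum_le[OF z, of "z \<odot> x" "max (norm (z \<odot> x)) (norm (x - z \<odot> x))" "x - z \<odot> x"]
      by (simp add: central_projectionD(3)[OF z] jp.diff_right)
    moreover have "norm (z \<odot> x) \<le> norm x" "norm (x - z \<odot> x) \<le> norm x"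
      using norm_central_mult_le[OF z, of x]
        norm_central_mult_le[OF central_projection_complement[OF z], of x]
      by (simp_all add: unit_minus_mult)
    ultimately show "norm g = max (norm (R g)) (norm (g - R g))"
      unfolding x R linear_diff[OF dual_linear, symmetric] dual_isometric by simp
  qed
  then interpret m_projection R .
  have "\<Phi> ` range ((\<odot>) z) = {g. R g = g}"
  proof (intro set_eqI iffI)
    fix g assume "g \<in> \<Phi> ` range ((\<odot>) z)"
    then show "g \<in> {g. R g = g}" by (auto simp: R central_projectionD(3)[OF z])
  next
    fix g assume "g \<in> {g. R g = g}"
    moreover obtain x where "g = \<Phi> x" using ex by blast
    ultimately have "g = \<Phi> (z \<odot> x)" by (simp add: R)
    then show "g \<in> \<Phi> ` range ((\<odot>) z)" by blast
  qed
  then show ?thesis using closedin_range by simp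
qed

lemma direct_sum_decomps_eq:
  fixes \<Phi> :: "'a \<Rightarrow> ('p::banach \<Rightarrow>\<^sub>L real)"
  assumes jbw: "jbw_algebra (\<odot>) \<Phi>"
  shows "direct_sum_decomps (\<odot>) \<Phi> = (\<lambda>z. (range ((\<odot>) z), range ((\<odot>) (e - z)))) ` central_projections"
proof (rule set_eqI, rule iffI)
  fix C assume "C \<in> direct_sum_decomps (\<odot>) \<Phi>"
  then have C: "jbw_direct_sum (\<odot>) \<Phi> (fst C) (snd C)" by (auto simp: direct_sum_decomps_def)
  obtain z where "z \<in> central_projections" "fst C = range ((\<odot>) z)" "snd C = range ((\<odot>) (e - z))"
  proof (rule algebra_direct_sum_central)
    show "0 \<in> fst C" "0 \<in> snd C"
      using C by (auto simp: jbw_direct_sum_def jbw_subalgebra_def subspace_0)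
    show "\<exists>!(a, b). a \<in> fst C \<and> b \<in> snd C \<and> x = a + b" for x
      using C by (simp add: jbw_direct_sum_def)
    show "(a + b) \<odot> (a' + b') = a \<odot> a' + b \<odot> b'"
      if "a \<in> fst C" "b \<in> snd C" "a' \<in> fst C" "b' \<in> snd C" for a b a' b'
      using C that by (simp add: jbw_direct_sum_def)
  qed
  then show "C \<in> (\<lambda>z. (range ((\<odot>) z), range ((\<odot>) (e - z)))) ` central_projections"
    by (intro image_eqI[of _ _ z]) (simp_all add: prod_eq_iff)
next
  fix C assume "C \<in> (\<lambda>z. (range ((\<odot>) z), range ((\<odot>) (e - z)))) ` central_projections"
  then obtain z where z: "z \<in> central_projections"
    and C: "C = (range ((\<odot>) z), range ((\<odot>) (e - z)))" by blast
  have sub: "jbw_subalgebra (\<odot>) \<Phi> (range ((\<odot>) q))" if q: "q \<in> central_projections" for q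
    unfolding jbw_subalgebra_def
  proof (intro conjI ballI)
    show "subspace (range ((\<odot>) q))"
      using linear_mult[of q] by (intro linear_subspace_image) auto
    show "x \<odot> y \<in> range ((\<odot>) q)" if "x \<in> range ((\<odot>) q)" "y \<in> range ((\<odot>) q)" for x y
      using that central_projectionD(2)[OF q, of x y] by (simp add: range_central_iff[OF q])
    show "closedin strong_operator_topology (\<Phi> ` range ((\<odot>) q))"
      by (rule closedin_range_central[OF jbw q])
  qed
  have "jbw_direct_sum (\<odot>) \<Phi> (range ((\<odot>) z)) (range ((\<odot>) (e - z)))"
    unfolding jbw_direct_sum_def
  proof (intro conjI allI ballI sub z central_projection_complement)
    fix x
    have "z \<odot> x \<in> range ((\<odot>) z) \<and> (e - z) \<odot> x \<in> range ((\<odot>) (e - z)) \<and> x = z \<odot> x + (e - z) \<odot> x"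
      by (simp add: unit_minus_mult)
    moreover have "a = z \<odot> x \<and> b = (e - z) \<odot> x"
      if "a \<in> range ((\<odot>) z)" "b \<in> range ((\<odot>) (e - z))" "x = a + b" for a b
      using that(1,2) unfolding range_central_iff[OF z] range_complement_iff[OF z] that(3)
      by (simp add: unit_minus_mult jp.add_right)
    ultimately show "\<exists>!(a, b). a \<in> range ((\<odot>) z) \<and> b \<in> range ((\<odot>) (e - z)) \<and> x = a + b"
      by (intro ex1I[of _ "(z \<odot> x, (e - z) \<odot> x)"]) auto
  next
    fix a b a' b'
    assume "a \<in> range ((\<odot>) z)" "b \<in> range ((\<odot>) (e - z))" "a' \<in> range ((\<odot>) z)" "b' \<in> range ((\<odot>) (e - z))"
    then have "z \<odot> a = a" "z \<odot> b = 0" "z \<odot> a' = a'" "z \<odot> b' = 0"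
      by (simp_all add: range_central_iff[OF z] range_complement_iff[OF z])
    then have "a \<odot> b' = 0" "b \<odot> a' = 0"
      using peirce_rules(1)[OF central_projectionD(1)[OF z]] commutative by metis+
    then show "(a + b) \<odot> (a' + b') = a \<odot> a' + b \<odot> b'"
      by (simp add: distribs)
  qed
  then show "C \<in> direct_sum_decomps (\<odot>) \<Phi>" by (simp add: C direct_sum_decomps_def)
qed

end

section \<open>Comparison of the five kinds of decomposition\<close>

theorem proposition3p3:
  fixes jp :: "'a::banach \<Rightarrow> 'a \<Rightarrow> 'a"
    and \<Phi> :: "'a \<Rightarrow> ('p::banach \<Rightarrow>\<^sub>L real)"
    and e :: 'a
  assumes "jbw_algebra jp \<Phi>"
    and "is_unit_element jp e"
    and "atomic jp"
  shows "((\<exists>M1 M2. (M1, M2) \<in> direct_sum_decomps jp \<Phi>) \<longleftrightarrow> (\<exists>S T. (S, T) \<in> order_decomps jp))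
    \<and> ((\<exists>S T. (S, T) \<in> order_decomps jp) \<longleftrightarrow> (\<exists>C1 C2. (C1, C2) \<in> cone_decomps jp))
    \<and> ((\<exists>C1 C2. (C1, C2) \<in> cone_decomps jp) \<longleftrightarrow> (\<exists>x y. (x, y) \<in> interval_decomps jp e))
    \<and> ((\<exists>x y. (x, y) \<in> interval_decomps jp e) \<longleftrightarrow> (\<exists>z. z \<in> central_decomps jp e))
    \<and> bij_betw (\<lambda>z. (range (jp z), range (jp (e - z)))) (central_decomps jp e) (direct_sum_decomps jp \<Phi>)
    \<and> bij_betw (\<lambda>(M1, M2). (M1, M2)) (direct_sum_decomps jp \<Phi>) (order_decomps jp)
    \<and> bij_betw (\<lambda>(S, T). (S \<inter> pos_cone jp, T \<inter> pos_cone jp)) (order_decomps jp) (cone_decomps jp)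
    \<and> bij_betw (\<lambda>z. (z, e - z)) (central_decomps jp e) (interval_decomps jp e)"
proof -
  interpret jbw_algebra jp \<Phi> by (rule assms(1))
  interpret unital_jb_algebra jp e
    by unfold_locales (rule assms(2))
  let ?Z = central_projections
  define D where "D = (\<lambda>z. (range (jp z), range (jp (e - z))))"
  define K where "K = (\<lambda>z. (P \<inter> range (jp z), P \<inter> range (jp (e - z))))"
  have sums: "direct_sum_decomps jp \<Phi> = D ` ?Z" and orders: "order_decomps jp = D ` ?Z"
    and cones: "cone_decomps jp = K ` ?Z"
    by (simp_all only: D_def K_def direct_sum_decomps_eq[OF assms(1)] order_decomps_eq cone_decomps_eq)
  have K_inj: "inj_on K ?Z"
    by (rule inj_onI) (auto simp: K_def intro: range_central_inj)
  have D_inj: "inj_on D ?Z"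
    by (rule inj_onI, rule range_central_inj) (simp_all add: D_def)
  have restrict: "(\<lambda>(S, T). (S \<inter> P, T \<inter> P)) (D z) = K z" for z
    by (simp add: D_def K_def Int_commute)
  have "bij_betw (\<lambda>(S, T). (S \<inter> P, T \<inter> P)) (D ` ?Z) (K ` ?Z)"
    unfolding bij_betw_def
  proof
    \<comment> \<open>Restriction to the cone composed with \<open>D\<close> is \<open>K\<close>, so
      its injectivity on the image of \<open>D\<close> is that of \<open>K\<close>.\<close>
    show "inj_on (\<lambda>(S, T). (S \<inter> P, T \<inter> P)) (D ` ?Z)"
      using K_inj by (intro inj_on_imageI) (simp add: inj_on_def restrict)
    show "(\<lambda>(S, T). (S \<inter> P, T \<inter> P)) ` D ` ?Z = K ` ?Z"
      unfolding image_image restrict ..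
  qed
  moreover have "bij_betw (\<lambda>z. (range (jp z), range (jp (e - z)))) ?Z (D ` ?Z)"
    using D_inj by (simp add: bij_betw_def D_def)
  moreover have "bij_betw (\<lambda>(M1, M2). (M1, M2)) (D ` ?Z) (D ` ?Z)"
    by (simp add: bij_betw_def inj_on_def)
  moreover have "bij_betw (\<lambda>z. (z, e - z)) ?Z ((\<lambda>z. (z, e - z)) ` ?Z)"
    by (simp add: bij_betw_def inj_on_def)
  \<comment> \<open>The trivial projection provides a witness for every existential
    statement.\<close>
  moreover have "0 \<in> ?Z"
    by (intro central_projectionI) (simp_all add: jp.zero_left)
  ultimately show ?thesis
    unfolding sums orders cones central_decomps_eq interval_decomps_eq
    by (intro conjI) (auto simp: D_def K_def)
qed

end
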